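(* Let $\Delta$ be a triangular configuration that can be embedded into $\mathbb{R}^3$. Then the cycle space $\ker\Delta$ (over $GF(2)$) has a 2-basis.
   Context: A triangular configuration is a finite two-dimensional simplicial complex (a finite set of geometric simplices, closed under taking faces, any two of which intersect in a common face or not at all) in which every maximal simplex is a triangle or a segment. Its incidence matrix over $GF(2)$ has rows indexed by the edges (1-simplices) and columns indexed by the triangles of $\Delta$, with entry $1$ iff the edge is a side of the triangle. The cycle space $\ker\Delta\subseteq GF(2)^{T(\Delta)}$ is the kernel of this matrix over $GF(2)$, where $T(\Delta)$ is the set of triangles. "Embeddable into $\mathbb{R}^3$" means $\Delta$ is isomorphic (as a simplicial complex) to a triangular configuration whose simplices lie in $\mathbb{R}^3$. A basis $B$ of a linear subspace of $GF(2)^m$ is a 2-basis if every coordinate is non-zero in at most two vectors of $B$. *)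

theory Defs
  imports "HOL-Analysis.Analysis" "HOL-Library.Z2" "HOL-Library.Function_Algebras"
begin

(* The empty simplex belongs to every nonempty "simplicial_complex", so the condition on the
   maximal simplices also rules out the complex {{}}; the empty complex is allowed.
   It bounds the dimension by 2, but complexes without triangles are not excluded. *)
definition triangular_configuration :: "'a::euclidean_space set set \<Rightarrow> bool" where
  "triangular_configuration K \<longleftrightarrow>
     simplicial_complex K \<and>
     (\<forall>S\<in>K. (\<forall>T\<in>K. S \<subseteq> T \<longrightarrow> T = S) \<longrightarrow> 2 simplex S \<or> 1 simplex S)"

definition triangles :: "'a::euclidean_space set set \<Rightarrow> 'a set set" where
  "triangles K = {S \<in> K. 2 simplex S}"

definition edges :: "'a::euclidean_space set set \<Rightarrow> 'a set set" where
  "edges K = {S \<in> K. 1 simplex S}"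

definition vertices :: "'a::euclidean_space set set \<Rightarrow> 'a set" where
  "vertices K = {v. {v} \<in> K}"

(* The abstract simplicial complex underlying K: the vertex sets of the simplices of K. *)
definition vertex_scheme :: "'a::euclidean_space set set \<Rightarrow> 'a set set" where
  "vertex_scheme K = (\<lambda>S. {v. v extreme_point_of S}) ` K"

definition simplicially_isomorphic ::
    "'a::euclidean_space set set \<Rightarrow> 'b::euclidean_space set set \<Rightarrow> bool" where
  "simplicially_isomorphic K L \<longleftrightarrow>
     (\<exists>f. bij_betw f (vertices K) (vertices L) \<and>
          (\<forall>A. A \<subseteq> vertices K \<longrightarrow> (A \<in> vertex_scheme K \<longleftrightarrow> f ` A \<in> vertex_scheme L)))"

definition embeddable_in_R3 :: "'a::euclidean_space set set \<Rightarrow> bool" where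
  "embeddable_in_R3 K \<longleftrightarrow>
     (\<exists>L :: (real^3) set set. triangular_configuration L \<and> simplicially_isomorphic K L)"

definition gf2_scale :: "bit \<Rightarrow> ('i \<Rightarrow> bit) \<Rightarrow> 'i \<Rightarrow> bit" where
  "gf2_scale c x = (\<lambda>i. c * x i)"

interpretation gf2: vector_space gf2_scale
  by unfold_locales (auto simp: gf2_scale_def fun_eq_iff algebra_simps)

definition incidence :: "'a::euclidean_space set \<Rightarrow> 'a set \<Rightarrow> bit" where
  "incidence e t = (if e face_of t then 1 else 0)"

(* GF(2)^I is represented by the functions into bit that vanish outside I. *)
definition cycle_space :: "'a::euclidean_space set set \<Rightarrow> ('a set \<Rightarrow> bit) set" where
  "cycle_space K = {x. (\<forall>t. t \<notin> triangles K \<longrightarrow> x t = 0) \<and>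
                       (\<forall>e\<in>edges K. (\<Sum>t\<in>triangles K. incidence e t * x t) = 0)}"

definition is_basis_of :: "('i \<Rightarrow> bit) set \<Rightarrow> ('i \<Rightarrow> bit) set \<Rightarrow> bool" where
  "is_basis_of B V \<longleftrightarrow> gf2.independent B \<and> gf2.span B = V"

definition two_basis :: "'i set \<Rightarrow> ('i \<Rightarrow> bit) set \<Rightarrow> ('i \<Rightarrow> bit) set \<Rightarrow> bool" where
  "two_basis I B V \<longleftrightarrow>
     is_basis_of B V \<and> (\<forall>i\<in>I. finite {b \<in> B. b i \<noteq> 0} \<and> card {b \<in> B. b i \<noteq> 0} \<le> 2)"

lemma subspace_cycle_space: "gf2.subspace (cycle_space K)"
  unfolding gf2.subspace_def
proof (intro conjI ballI allI)
  fix x y :: "'a set \<Rightarrow> bit" and c :: bit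
  assume x: "x \<in> cycle_space K"
  show "gf2_scale c x \<in> cycle_space K"
    using x by (cases c) (simp_all add: cycle_space_def gf2_scale_def)
  assume y: "y \<in> cycle_space K"
  have "(\<Sum>t\<in>triangles K. incidence e t * (x + y) t) = 0" if "e \<in> edges K" for e
  proof -
    have "(\<Sum>t\<in>triangles K. incidence e t * (x + y) t) =
        (\<Sum>t\<in>triangles K. incidence e t * x t) + (\<Sum>t\<in>triangles K. incidence e t * y t)"
      by (simp only: plus_fun_apply distrib_left sum.distrib)
    moreover have "(\<Sum>t\<in>triangles K. incidence e t * x t) = 0"
      "(\<Sum>t\<in>triangles K. incidence e t * y t) = 0"
      using x y that unfolding cycle_space_def mem_Collect_eq by blast+
    ultimately show ?thesis
      by (simp only: add_0)
  qed
  moreover have "(x + y) t = 0" if "t \<notin> triangles K" for t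
    using x y that by (simp add: cycle_space_def)
  ultimately show "x + y \<in> cycle_space K"
    unfolding cycle_space_def mem_Collect_eq by blast
qed (simp add: cycle_space_def)

end

theory Submission
  imports Defs
begin

text \<open>
  Let the configuration lie in space and let \<open>X\<close> be the union of its triangles. Every triangle has
  two sides in the complement of \<open>X\<close>, so each component of the complement (cell) has a boundary
  vector over \<open>GF(2)\<close>, and every triangle occurs in at most two of these vectors, namely those of
  the cells at its two sides. It remains to see that the boundary vectors span the cycle space; an
  independent subset with the same span is then a 2-basis.

  More generally, a function constant on the cells has a jump at every triangle. The jumps form
  a cycle: run around a small triangle encircling an edge and add up the changes. Conversely, a cycle
  \<open>x\<close> is the jump of the colouring sending a point \<open>p\<close> to the number modulo 2 of triangles of \<open>x\<close>
  crossed by the segment from a fixed point \<open>o\<close> to \<open>p\<close>. Both directions rest on one parity fact: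
  for two triangles in general position, the number of edges of either triangle that meet the other
  triangle is even. Summed over the triangles of a cycle, it shows that the boundary of a generic
  triangle crosses the cycle an even number of times.
\<close>

subsection \<open>Two triangles in general position\<close>

text \<open>The spanning statement is a case of mod 2 Alexander duality, relating the second
  homology of \<open>X\<close> to the components of its complement; counting crossings makes it
  elementary. An edge may lie in any number of triangles and \<open>X\<close> need not be connected
  or a manifold, so no local orientation or inside/outside is at hand. The obstacle is degeneracy: a
  count is meaningful only when segments avoid edges and cross planes properly, and a point that
  suits one segment may not suit another. Hence values are computed only at points generic relative
  to finitely many given ones. Such points are dense, and the colouring extends from them to whole
  components. A triangle with the same cell on both sides has coefficient 0 in every boundary
  vector, hence in every cycle. All cell boundaries together add up to zero, each triangle being
  counted once from either side. The family is therefore dependent as soon as there is a triangle,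
  which is why a basis has to be extracted from it.\<close>

lemma bit_add_eq_0: "x + y = 0 \<Longrightarrow> x = (y::bit)"
  by (cases x; cases y) auto

lemma bit_add_self: "x + x = (0::bit)"
  by (cases x) auto

text \<open>Each of the two sums is 1 exactly when the pairs separate each other on the line, a
  condition symmetric in the pairs. Degenerate pairs \<open>a = b\<close> or \<open>c = d\<close>
  are allowed.\<close>

lemma real_segments_interlace_parity:
  fixes a b c d :: real
  assumes "a \<noteq> c" "a \<noteq> d" "b \<noteq> c" "b \<noteq> d"
  shows "of_bool (a \<in> closed_segment c d) + of_bool (b \<in> closed_segment c d)
       + (of_bool (c \<in> closed_segment a b) + of_bool (d \<in> closed_segment a b)) = (0::bit)"
proof -
  have ivl: "(a \<in> {c..d}) \<noteq> (b \<in> {c..d}) \<longleftrightarrow> (c \<in> {a..b}) \<noteq> (d \<in> {a..b})"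
    if "a \<le> b" "c \<le> d" "a \<noteq> c" "a \<noteq> d" "b \<noteq> c" "b \<noteq> d" for a b c d :: real
    unfolding atLeastAtMost_iff using that
    by (cases "a < c"; cases "a < d"; cases "b < c"; cases "b < d") auto
  have "(a \<in> closed_segment c d) \<noteq> (b \<in> closed_segment c d)
    \<longleftrightarrow> (c \<in> closed_segment a b) \<noteq> (d \<in> closed_segment a b)"
  proof -
    consider "a \<le> b" "c \<le> d" | "b \<le> a" "c \<le> d" | "a \<le> b" "d \<le> c" | "b \<le> a" "d \<le> c" by linarith
    then show ?thesis
    proof cases
      case 1 then show ?thesis using ivl[of a b c d] assms by (simp add: closed_segment_eq_real_ivl1)
    next
      case 2 then show ?thesis using ivl[of b a c d] assms
        by (simp add: closed_segment_eq_real_ivl1 closed_segment_commute[of a b]) metis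
    next
      case 3 then show ?thesis using ivl[of a b d c] assms
        by (simp add: closed_segment_eq_real_ivl1 closed_segment_commute[of c d]) metis
    next
      case 4 then show ?thesis using ivl[of b a d c] assms
        by (simp add: closed_segment_eq_real_ivl1 closed_segment_commute[of a b] closed_segment_commute[of c d]) metis
    qed
  qed
  then show ?thesis by (auto simp: of_bool_def)
qed

text \<open>A parametrisation of the common line turns the points into real numbers. It is
  injective, since its direction cannot vanish when \<open>a\<close> and \<open>c\<close>
  differ.\<close>

lemma collinear_segments_interlace_parity:
  fixes a b c d :: "'a::euclidean_space"
  assumes col: "collinear {a, b, c, d}" and ne: "a \<noteq> c" "a \<noteq> d" "b \<noteq> c" "b \<noteq> d"
  shows "of_bool (a \<in> closed_segment c d) + of_bool (b \<in> closed_segment c d)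
       + (of_bool (c \<in> closed_segment a b) + of_bool (d \<in> closed_segment a b)) = (0::bit)"
proof -
  obtain u v \<alpha> \<beta> \<gamma> \<delta> where par: "a = u + \<alpha> *\<^sub>R v" "b = u + \<beta> *\<^sub>R v" "c = u + \<gamma> *\<^sub>R v" "d = u + \<delta> *\<^sub>R v"
    using col unfolding collinear_alt by (metis insertI1 insertI2)
  have "v \<noteq> 0" using par ne by auto
  then have inj: "inj (\<lambda>t::real. t *\<^sub>R v)" by (simp add: inj_on_def)
  have seg: "u + s *\<^sub>R v \<in> closed_segment (u + p *\<^sub>R v) (u + q *\<^sub>R v) \<longleftrightarrow> s \<in> closed_segment p q" for s p q :: real
  proof -
    have "closed_segment (p *\<^sub>R v) (q *\<^sub>R v) = (\<lambda>t::real. t *\<^sub>R v) ` closed_segment p q"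
      by (rule closed_segment_linear_image) (simp add: linear_iff scaleR_left_distrib)
    then show ?thesis using inj_image_mem_iff[OF inj] by simp
  qed
  show ?thesis unfolding par seg
    by (rule real_segments_interlace_parity) (use ne par in auto)
qed

text \<open>On an edge from \<open>v\<close> the value \<open>k\<close> is taken once, at the point
  dividing the edge in the ratio of the gaps of its two ends to \<open>k\<close>. Any other point of
  the section is then rewritten as a combination of the two cut points.\<close>

lemma triangle_lone_vertex_section:
  fixes h v w1 w2 :: "'a::euclidean_space"
  assumes v: "h \<bullet> v < k" and w1: "h \<bullet> w1 > k" and w2: "h \<bullet> w2 > k"
  obtains y1 y2 where "convex hull {v, w1, w2} \<inter> {x. h \<bullet> x = k} = closed_segment y1 y2"
    "convex hull {v, w1} \<inter> {x. h \<bullet> x = k} = {y1}"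
    "convex hull {v, w2} \<inter> {x. h \<bullet> x = k} = {y2}"
    "convex hull {w1, w2} \<inter> {x. h \<bullet> x = k} = {}"
proof -
  define p where "p = k - h \<bullet> v"
  have p: "p > 0" using v by (simp add: p_def)
  define y where "y w = (let q = h \<bullet> w - k in (q / (p + q)) *\<^sub>R v + (p / (p + q)) *\<^sub>R w)" for w
  have y_seg: "y w \<in> convex hull {v, w}" and y_h: "h \<bullet> y w = k"
    and y_unique: "\<And>x. x \<in> convex hull {v, w} \<Longrightarrow> h \<bullet> x = k \<Longrightarrow> x = y w" if "h \<bullet> w > k" for w
  proof -
    define q where "q = h \<bullet> w - k"
    have q: "q > 0" using that by (simp add: q_def)
    have yw: "y w = (q / (p + q)) *\<^sub>R v + (p / (p + q)) *\<^sub>R w"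
      by (simp add: y_def q_def Let_def)
    have s1: "q / (p + q) + p / (p + q) = 1" using p q by (simp add: add_divide_distrib[symmetric])
    show "y w \<in> convex hull {v, w}"
      unfolding convex_hull_2 yw using p q s1 by force
    have hv: "h \<bullet> v = k - p" "h \<bullet> w = k + q" by (auto simp: p_def q_def)
    show "h \<bullet> y w = k"
    proof -
      have "h \<bullet> y w = (q / (p + q) + p / (p + q)) * k"
        by (simp add: yw inner_add_right hv algebra_simps add_divide_distrib diff_divide_distrib)
      then show ?thesis using s1 by simp
    qed
    show "x = y w" if x: "x \<in> convex hull {v, w}" and hx: "h \<bullet> x = k" for x
    proof -
      obtain \<alpha> \<beta> where ab: "\<alpha> + \<beta> = 1" "x = \<alpha> *\<^sub>R v + \<beta> *\<^sub>R w"
        using x unfolding convex_hull_2 by blast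
      have "\<alpha> * (k - p) + \<beta> * (k + q) = k" using hx ab by (simp add: inner_add_right hv)
      then have "(\<alpha> + \<beta>) * k - \<alpha> * p + \<beta> * q = k" by (simp add: algebra_simps)
      then have "\<alpha> * p = \<beta> * q" using ab by simp
      moreover have "(\<alpha> + \<beta>) * q = q" "(\<alpha> + \<beta>) * p = p" using ab by simp_all
      ultimately have "\<alpha> * (p + q) = q" "\<beta> * (p + q) = p" by (simp_all add: distrib_left distrib_right)
      then have "\<alpha> = q / (p + q)" "\<beta> = p / (p + q)" using p q by (simp_all add: field_simps)
      then show ?thesis using ab yw by simp
    qed
  qed
  have seg: "convex hull {v, w} \<inter> {x. h \<bullet> x = k} = {y w}" if "h \<bullet> w > k" for w
    using y_seg[OF that] y_h[OF that] y_unique[OF that] by blast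
  have "convex hull {v, w1, w2} \<inter> {x. h \<bullet> x = k} = closed_segment (y w1) (y w2)"
  proof
    have "y w1 \<in> convex hull {v, w1, w2}" "y w2 \<in> convex hull {v, w1, w2}"
      using y_seg[OF w1] y_seg[OF w2] hull_mono[of "{v,w1}" "{v,w1,w2}"] hull_mono[of "{v,w2}" "{v,w1,w2}"] by auto
    then have "y w1 \<in> convex hull {v, w1, w2} \<inter> {x. h \<bullet> x = k}" "y w2 \<in> convex hull {v, w1, w2} \<inter> {x. h \<bullet> x = k}"
      using y_h w1 w2 by auto
    moreover have "convex (convex hull {v, w1, w2} \<inter> {x. h \<bullet> x = k})"
      by (intro convex_Int convex_hyperplane) auto
    ultimately show "closed_segment (y w1) (y w2) \<subseteq> convex hull {v, w1, w2} \<inter> {x. h \<bullet> x = k}"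
      by (rule closed_segment_subset)
    show "convex hull {v, w1, w2} \<inter> {x. h \<bullet> x = k} \<subseteq> closed_segment (y w1) (y w2)"
    proof
      fix x assume "x \<in> convex hull {v, w1, w2} \<inter> {x. h \<bullet> x = k}"
      then obtain \<alpha> \<beta> \<gamma> where x: "\<alpha> \<ge> 0" "\<beta> \<ge> 0" "\<gamma> \<ge> 0" "\<alpha> + \<beta> + \<gamma> = 1" "x = \<alpha> *\<^sub>R v + \<beta> *\<^sub>R w1 + \<gamma> *\<^sub>R w2"
        and hx: "h \<bullet> x = k" unfolding convex_hull_3 by auto
      define q1 q2 where "q1 = h \<bullet> w1 - k" and "q2 = h \<bullet> w2 - k"
      have q: "q1 > 0" "q2 > 0" using w1 w2 by (auto simp: q1_def q2_def)
      have hv: "h \<bullet> v = k - p" "h \<bullet> w1 = k + q1" "h \<bullet> w2 = k + q2" by (auto simp: p_def q1_def q2_def)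
      have "\<alpha> * (k - p) + \<beta> * (k + q1) + \<gamma> * (k + q2) = k" using hx x by (simp add: inner_add_right hv)
      then have "(\<alpha> + \<beta> + \<gamma>) * k - \<alpha> * p + \<beta> * q1 + \<gamma> * q2 = k" by (simp add: algebra_simps)
      then have ap: "\<alpha> * p = \<beta> * q1 + \<gamma> * q2" using x(4) by simp
      \<comment> \<open>The weights are dictated by the coefficients at \<open>w1\<close> and
        \<open>w2\<close>: those of \<open>\<mu> *\<^sub>R y w1\<close> and
        \<open>\<nu> *\<^sub>R y w2\<close> must be \<beta> and \<gamma>. That the coefficients at
        \<open>v\<close> then add up to \<alpha> is the plane equation in the form
        \<open>ap\<close>.\<close>
      define \<mu> \<nu> where "\<mu> = \<beta> * (p + q1) / p" and "\<nu> = \<gamma> * (p + q2) / p"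
      have mn: "\<mu> + \<nu> = 1" "\<mu> \<ge> 0" "\<nu> \<ge> 0"
      proof -
        have "\<mu> + \<nu> = (\<beta> * p + \<gamma> * p + (\<beta> * q1 + \<gamma> * q2)) / p"
          unfolding \<mu>_def \<nu>_def by (simp add: algebra_simps add_divide_distrib)
        also have "\<dots> = (\<alpha> + \<beta> + \<gamma>) * p / p" unfolding ap[symmetric] by (simp add: algebra_simps)
        finally show "\<mu> + \<nu> = 1" using x(4) p by simp
      qed (use p q x in \<open>auto simp: \<mu>_def \<nu>_def\<close>)
      have y1: "\<mu> *\<^sub>R y w1 = (\<beta> * q1 / p) *\<^sub>R v + \<beta> *\<^sub>R w1"
        using p q by (simp add: y_def Let_def q1_def[symmetric] \<mu>_def scaleR_add_right)
      have y2: "\<nu> *\<^sub>R y w2 = (\<gamma> * q2 / p) *\<^sub>R v + \<gamma> *\<^sub>R w2"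
        using p q by (simp add: y_def Let_def q2_def[symmetric] \<nu>_def scaleR_add_right)
      have "\<alpha> = \<beta> * q1 / p + \<gamma> * q2 / p" using ap p by (simp add: field_simps)
      then have "x = \<mu> *\<^sub>R y w1 + \<nu> *\<^sub>R y w2"
        unfolding y1 y2 x(5) by (simp add: scaleR_add_left)
      then have "x \<in> convex hull {y w1, y w2}" using mn unfolding convex_hull_2 by blast
      then show "x \<in> closed_segment (y w1) (y w2)" by (simp add: segment_convex_hull)
    qed
  qed
  moreover have "convex hull {w1, w2} \<inter> {x. h \<bullet> x = k} = {}"
  proof -
    have "convex hull {w1, w2} \<subseteq> {x. h \<bullet> x > k}"
      using w1 w2 by (intro hull_minimal convex_halfspace_gt) auto
    then show ?thesis by auto
  qed
  ultimately show ?thesis using that seg w1 w2 by blast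
qed

text \<open>With no vertex on the plane, either all vertices lie on one side or one of them is alone
  on its side. In the second outcome \<open>v3\<close> is the lone vertex, so the edge opposite to
  it is the one that is missed.\<close>

lemma triangle_hyperplane_section:
  fixes h :: "'a::euclidean_space"
  assumes card: "card V = 3" and off: "\<And>v. v \<in> V \<Longrightarrow> h \<bullet> v \<noteq> k"
  obtains "convex hull V \<inter> {x. h \<bullet> x = k} = {}"
  | v1 v2 v3 y1 y2 where "V = {v1, v2, v3}" "v1 \<noteq> v2" "v1 \<noteq> v3" "v2 \<noteq> v3"
    "convex hull V \<inter> {x. h \<bullet> x = k} = closed_segment y1 y2"
    "convex hull (V - {v1}) \<inter> {x. h \<bullet> x = k} = {y1}"
    "convex hull (V - {v2}) \<inter> {x. h \<bullet> x = k} = {y2}"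
    "convex hull (V - {v3}) \<inter> {x. h \<bullet> x = k} = {}"
proof -
  note sections = that
  have lone: thesis if V: "V = {a, b, c}" "a \<noteq> b" "a \<noteq> c" "b \<noteq> c" and
    s: "h \<bullet> a < k \<and> h \<bullet> b > k \<and> h \<bullet> c > k \<or> h \<bullet> a > k \<and> h \<bullet> b < k \<and> h \<bullet> c < k" for a b c
  proof -
    obtain y1 y2 where y: "convex hull {a, b, c} \<inter> {x. h \<bullet> x = k} = closed_segment y1 y2"
      "convex hull {a, b} \<inter> {x. h \<bullet> x = k} = {y1}"
      "convex hull {a, c} \<inter> {x. h \<bullet> x = k} = {y2}"
      "convex hull {b, c} \<inter> {x. h \<bullet> x = k} = {}" using s
    proof
      assume "h \<bullet> a < k \<and> h \<bullet> b > k \<and> h \<bullet> c > k"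
      then show ?thesis using triangle_lone_vertex_section[where h = h and v = a and k = k and ?w1.0 = b and ?w2.0 = c] that by blast
    next
      assume "h \<bullet> a > k \<and> h \<bullet> b < k \<and> h \<bullet> c < k"
      \<comment> \<open>Negating \<open>h\<close> and \<open>k\<close> keeps the plane and exchanges
        its sides.\<close>
      then obtain y1 y2 where "convex hull {a, b, c} \<inter> {x. - h \<bullet> x = - k} = closed_segment y1 y2"
        "convex hull {a, b} \<inter> {x. - h \<bullet> x = - k} = {y1}"
        "convex hull {a, c} \<inter> {x. - h \<bullet> x = - k} = {y2}"
        "convex hull {b, c} \<inter> {x. - h \<bullet> x = - k} = {}"
        using triangle_lone_vertex_section[where h = "-h" and v = a and k = "-k" and ?w1.0 = b and ?w2.0 = c]
        by (auto simp only: inner_minus_left neg_less_iff_less)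
      then show ?thesis unfolding inner_minus_left neg_equal_iff_equal by (rule that)
    qed
    have "V - {c} = {a, b}" "V - {b} = {a, c}" "V - {a} = {b, c}" using V by auto
    moreover have "V = {c, b, a}" using V by auto
    ultimately show ?thesis using V y by (intro sections(2)[of c b a y1 y2]) simp_all
  qed
  obtain a b c where V: "V = {a, b, c}" "a \<noteq> b" "a \<noteq> c" "b \<noteq> c"
    using card by (auto simp: card_3_iff)
  have V': "V = {b, a, c}" "V = {c, a, b}" using V by auto
  have o: "h \<bullet> a < k \<or> h \<bullet> a > k" "h \<bullet> b < k \<or> h \<bullet> b > k" "h \<bullet> c < k \<or> h \<bullet> c > k"
    using off[of a] off[of b] off[of c] V by auto
  consider "V \<subseteq> {x. h \<bullet> x > k}" | "V \<subseteq> {x. h \<bullet> x < k}"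
    | "h \<bullet> a < k \<and> h \<bullet> b > k \<and> h \<bullet> c > k \<or> h \<bullet> a > k \<and> h \<bullet> b < k \<and> h \<bullet> c < k"
    | "h \<bullet> b < k \<and> h \<bullet> a > k \<and> h \<bullet> c > k \<or> h \<bullet> b > k \<and> h \<bullet> a < k \<and> h \<bullet> c < k"
    | "h \<bullet> c < k \<and> h \<bullet> a > k \<and> h \<bullet> b > k \<or> h \<bullet> c > k \<and> h \<bullet> a < k \<and> h \<bullet> b < k"
    using o V(1) by auto
  then show ?thesis
  proof cases
    case 1
    then have "convex hull V \<subseteq> {x. h \<bullet> x > k}" by (intro hull_minimal convex_halfspace_gt)
    then show ?thesis using that(1) by auto
  next
    case 2
    then have "convex hull V \<subseteq> {x. h \<bullet> x < k}" by (intro hull_minimal convex_halfspace_lt)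
    then show ?thesis using that(1) by auto
  next
    case 3 then show ?thesis using lone[OF V] by blast
  next
    case 4 then show ?thesis using lone[OF V'(1)] V by blast
  next
    case 5 then show ?thesis using lone[OF V'(2)] V by blast
  qed
qed

lemma sum_triple:
  fixes g :: "'a \<Rightarrow> 'b::comm_monoid_add"
  assumes "S = {a, b, c}" "a \<noteq> b" "a \<noteq> c" "b \<noteq> c"
  shows "sum g S = g a + g b + g c"
  using assms by (simp add: add.assoc)

text \<open>The two triangles meet in a segment, each end of which is a point where an edge of one
  triangle meets the other triangle.\<close>
lemma triangles_crossing_parity:
  fixes h n :: "'a::euclidean_space"
  assumes S: "card S = 3" "S \<subseteq> {x. h \<bullet> x = k}" "\<And>a. a \<in> S \<Longrightarrow> n \<bullet> a \<noteq> b"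
    and T: "card T = 3" "T \<subseteq> {x. n \<bullet> x = b}" "\<And>v. v \<in> T \<Longrightarrow> h \<bullet> v \<noteq> k"
    and disj: "\<And>a v. a \<in> S \<Longrightarrow> v \<in> T \<Longrightarrow> convex hull (S - {a}) \<inter> convex hull (T - {v}) = {}"
    and line: "collinear ({x. h \<bullet> x = k} \<inter> {x. n \<bullet> x = b})"
  shows "(\<Sum>a\<in>S. of_bool (convex hull (S - {a}) \<inter> convex hull T \<noteq> {}))
       + (\<Sum>v\<in>T. of_bool (convex hull (T - {v}) \<inter> convex hull S \<noteq> {})) = (0::bit)"
proof -
  let ?A = "{x. h \<bullet> x = k}" and ?B = "{x. n \<bullet> x = b}"
  have hS: "convex hull S' \<subseteq> ?A" if "S' \<subseteq> S" for S'
    using that S by (intro hull_minimal convex_hyperplane) auto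
  have hT: "convex hull T' \<subseteq> ?B" if "T' \<subseteq> T" for T'
    using that T by (intro hull_minimal convex_hyperplane) auto
  \<comment> \<open>Each triangle lies in its own plane, so every intersection of an edge with the
    other triangle can be computed from the traces of both on the common line of the planes.\<close>
  have eqS: "convex hull (S - {a}) \<inter> convex hull T = (convex hull (S - {a}) \<inter> ?B) \<inter> (convex hull T \<inter> ?A)" for a
    using hS[of "S - {a}"] hT[of T] by auto
  have eqT: "convex hull (T - {v}) \<inter> convex hull S = (convex hull (T - {v}) \<inter> ?A) \<inter> (convex hull S \<inter> ?B)" for v
    using hT[of "T - {v}"] hS[of S] by auto
  show ?thesis
  proof (rule triangle_hyperplane_section[OF S(1,3)])
    assume e: "convex hull S \<inter> ?B = {}"
    moreover have "convex hull (S - {a}) \<subseteq> convex hull S" for a by (intro hull_mono) auto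
    ultimately have "convex hull (S - {a}) \<inter> ?B = {}" for a by blast
    then show ?thesis unfolding eqS eqT e by simp
  next
    fix a1 a2 a3 s1 s2
    assume Seq: "S = {a1, a2, a3}" "a1 \<noteq> a2" "a1 \<noteq> a3" "a2 \<noteq> a3"
      and s: "convex hull S \<inter> ?B = closed_segment s1 s2" "convex hull (S - {a1}) \<inter> ?B = {s1}"
         "convex hull (S - {a2}) \<inter> ?B = {s2}" "convex hull (S - {a3}) \<inter> ?B = {}"
    show ?thesis
    proof (rule triangle_hyperplane_section[OF T(1,3)])
      assume e: "convex hull T \<inter> ?A = {}"
      moreover have "convex hull (T - {a}) \<subseteq> convex hull T" for a by (intro hull_mono) auto
      ultimately have "convex hull (T - {a}) \<inter> ?A = {}" for a by blast
      then show ?thesis unfolding eqS eqT e by simp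
    next
      fix v1 v2 v3 y1 y2
      assume Teq: "T = {v1, v2, v3}" "v1 \<noteq> v2" "v1 \<noteq> v3" "v2 \<noteq> v3"
        and y: "convex hull T \<inter> ?A = closed_segment y1 y2" "convex hull (T - {v1}) \<inter> ?A = {y1}"
         "convex hull (T - {v2}) \<inter> ?A = {y2}" "convex hull (T - {v3}) \<inter> ?A = {}"
      note sumS = sum_triple[OF Seq] and sumT = sum_triple[OF Teq]
      have "{s1, s2, y1, y2} \<subseteq> ?A \<inter> ?B"
        using s y hS[of "S - {a1}"] hS[of "S - {a2}"] hT[of "T - {v1}"] hT[of "T - {v2}"] by auto
      then have col: "collinear {s1, s2, y1, y2}" using line collinear_subset by blast
      have ne: "s1 \<noteq> y1" "s1 \<noteq> y2" "s2 \<noteq> y1" "s2 \<noteq> y2"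
        using disj[of a1 v1] disj[of a1 v2] disj[of a2 v1] disj[of a2 v2] s y Seq Teq by blast+
      show ?thesis
        unfolding sumS sumT eqS eqT s y
        using collinear_segments_interlace_parity[OF col ne] by simp
    qed
  qed
qed

lemma plane_through_triangle:
  fixes S :: "(real^3) set"
  assumes "card S = 3" "\<not> affine_dependent S"
  obtains h k where "h \<noteq> 0" "affine hull S = {x. h \<bullet> x = k}"
proof -
  have "aff_dim S = DIM(real^3) - 1"
    using assms by (simp add: affine_independent_iff_card)
  then show ?thesis using that unfolding aff_dim_eq_hyperplane by blast
qed

text \<open>Dimension three enters twice: a triangle spans a hyperplane, and two such planes meet in
  at most a line, because a vertex of \<open>T\<close> lies off the plane of
  \<open>S\<close>.\<close>

lemma independent_triangles_crossing_parity:
  fixes S T :: "(real^3) set"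
  assumes S: "card S = 3" "\<not> affine_dependent S" "\<And>a. a \<in> S \<Longrightarrow> a \<notin> affine hull T"
    and T: "card T = 3" "\<not> affine_dependent T" "\<And>v. v \<in> T \<Longrightarrow> v \<notin> affine hull S"
    and disj: "\<And>a v. a \<in> S \<Longrightarrow> v \<in> T \<Longrightarrow> convex hull (S - {a}) \<inter> convex hull (T - {v}) = {}"
  shows "(\<Sum>a\<in>S. of_bool (convex hull (S - {a}) \<inter> convex hull T \<noteq> {}))
       + (\<Sum>v\<in>T. of_bool (convex hull (T - {v}) \<inter> convex hull S \<noteq> {})) = (0::bit)"
proof -
  obtain h k where h: "h \<noteq> 0" "affine hull S = {x. h \<bullet> x = k}"
    using plane_through_triangle S by blast
  obtain n b where n: "n \<noteq> 0" "affine hull T = {x. n \<bullet> x = b}"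
    using plane_through_triangle T by blast
  have "T \<noteq> {}" using T(1) by auto
  then have not_sub: "\<not> affine hull T \<subseteq> {x. h \<bullet> x = k}"
    using T(3) h by (metis all_not_in_conv hull_inc subsetD)
  have "aff_dim (affine hull T \<inter> {x. h \<bullet> x = k}) \<le> 1"
  proof -
    have "aff_dim (affine hull T) = 2" using T by (simp add: affine_independent_iff_card)
    then show ?thesis using not_sub by (simp add: aff_dim_affine_Int_hyperplane)
  qed
  then have "collinear ({x. h \<bullet> x = k} \<inter> {x. n \<bullet> x = b})"
    unfolding n by (simp add: collinear_aff_dim Int_commute)
  moreover have "S \<subseteq> {x. h \<bullet> x = k}" "T \<subseteq> {x. n \<bullet> x = b}"
    using hull_subset h n by (metis, metis)
  ultimately show ?thesis
    using S T h n disj by (intro triangles_crossing_parity[of S h k n b T]) auto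
qed

subsection \<open>General position\<close>

text \<open>The bound 3 makes the avoided set a finite union of planes, which is negligible, while
  four points chosen successively in this way are still affinely independent.\<close>
definition generic :: "(real^3) set \<Rightarrow> real^3 \<Rightarrow> bool" where
  "generic F p \<longleftrightarrow> (\<forall>G\<subseteq>F. finite G \<and> card G \<le> 3 \<longrightarrow> p \<notin> affine hull G)"

lemma genericD: "generic F p \<Longrightarrow> G \<subseteq> F \<Longrightarrow> finite G \<Longrightarrow> card G \<le> 3 \<Longrightarrow> p \<notin> affine hull G"
  by (simp add: generic_def)

lemma generic_mono: "generic F p \<Longrightarrow> G \<subseteq> F \<Longrightarrow> generic G p"
  by (auto simp: generic_def)

lemma generic_notin: "generic F p \<Longrightarrow> v \<in> F \<Longrightarrow> p \<noteq> v"
  using genericD[of F p "{v}"] by auto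

lemma negligible_affine_hull_card_le:
  fixes G :: "'a::euclidean_space set"
  assumes "finite G" "card G \<le> DIM('a)"
  shows "negligible (affine hull G)"
proof -
  have "aff_dim G < int (DIM('a))" using aff_dim_le_card[OF assms(1)] assms(2) by simp
  then have "interior (affine hull G) = {}"
    by (intro low_dim_interior) auto
  then show ?thesis by (simp add: negligible_convex_interior)
qed

text \<open>A nonempty open set is not negligible. The additional set \<open>N\<close> carries
  conditions on a point that are not about hulls of points of \<open>F\<close>, such as those on a
  further point computed from it.\<close>

lemma generic_exists:
  assumes "finite F" "open S" "S \<noteq> {}" "negligible N"
  obtains p where "p \<in> S" "generic F p" "p \<notin> N"
proof -
  define H where "H = {G. G \<subseteq> F \<and> card G \<le> 3}"
  have "finite H" using assms(1) by (simp add: H_def)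
  moreover have "negligible (affine hull G)" if "G \<in> H" for G
    using that assms(1) by (intro negligible_affine_hull_card_le) (auto simp: H_def intro: finite_subset)
  ultimately have "negligible (\<Union>G\<in>H. affine hull G)" by (intro negligible_Union) auto
  then have "negligible ((\<Union>G\<in>H. affine hull G) \<union> N)" using assms(4) by simp
  then have "\<not> S \<subseteq> (\<Union>G\<in>H. affine hull G) \<union> N"
    using open_not_negligible[OF assms(2,3)] negligible_subset by blast
  then obtain p where "p \<in> S" "p \<notin> (\<Union>G\<in>H. affine hull G) \<union> N" by blast
  then show ?thesis using that[of p] by (auto simp: generic_def H_def)
qed

lemma affine_independent_insert_generic:
  assumes "\<not> affine_dependent G" "generic F p" "G \<subseteq> F" "card G \<le> 3"
  shows "\<not> affine_dependent (insert p G)"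
  using assms genericD[of F p G] by (intro affine_independent_insert) (auto simp: aff_independent_finite)

text \<open>Genericity is imposed successively so that the relevant quadruples are tetrahedra:
  \<open>o'\<close>, \<open>p\<close>, \<open>q\<close> with a corner of \<open>T\<close> gives a
  corner off the plane of \<open>o'\<close>, \<open>p\<close>, \<open>q\<close>, and two of
  \<open>o'\<close>, \<open>p\<close>, \<open>q\<close> with two corners gives disjoint edges, being
  opposite in the tetrahedron.\<close>

lemma generic_triangle_crossing_parity:
  fixes T :: "(real^3) set"
  assumes T: "card T = 3" "\<not> affine_dependent T"
    and o: "generic T o'" and p: "generic (insert o' T) p" and q: "generic (insert o' (insert p T)) q"
  shows "of_bool (closed_segment o' p \<inter> convex hull T \<noteq> {}) + of_bool (closed_segment p q \<inter> convex hull T \<noteq> {})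
       + of_bool (closed_segment o' q \<inter> convex hull T \<noteq> {})
       = (\<Sum>v\<in>T. of_bool (convex hull (T - {v}) \<inter> convex hull {o', p, q} \<noteq> {}) :: bit)"
proof -
  have fin: "finite T" using T by (simp add: aff_independent_finite)
  have ne: "o' \<noteq> p" "o' \<noteq> q" "p \<noteq> q" using generic_notin[OF p] generic_notin[OF q] by auto
  have ov: "o' \<noteq> v" "p \<noteq> v" "q \<noteq> v" if "v \<in> T" for v
    using generic_notin[OF o] generic_notin[OF p] generic_notin[OF q] that by auto
  have sub: "\<not> affine_dependent (insert o' G)" "\<not> affine_dependent (insert p G)" "\<not> affine_dependent (insert q G)"
    if "G \<subseteq> T" "card G \<le> 3" for G
  proof -
    have G: "\<not> affine_dependent G" using T(2) that affine_dependent_subset by blast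
    show "\<not> affine_dependent (insert o' G)"
      using that by (intro affine_independent_insert_generic[OF G o]) auto
    show "\<not> affine_dependent (insert p G)"
      using that by (intro affine_independent_insert_generic[OF G p]) auto
    show "\<not> affine_dependent (insert q G)"
      using that by (intro affine_independent_insert_generic[OF G q]) auto
  qed
  have indep4: "\<not> affine_dependent {q, p, o', v}" if v: "v \<in> T" for v
  proof -
    have c: "card {o', v} \<le> 3" "card {p, o', v} \<le> 3"
      using ov[OF v] ne by simp_all
    have "\<not> affine_dependent {o', v}" using sub(1)[of "{v}"] v by simp
    then have "\<not> affine_dependent {p, o', v}"
      using v c by (intro affine_independent_insert_generic[OF _ p]) auto
    then show ?thesis
      using v c by (intro affine_independent_insert_generic[OF _ q]) auto
  qed
  have offS: "v \<notin> affine hull {o', p, q}" if v: "v \<in> T" for v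
  proof -
    have "affine hull {o', p, q} \<inter> affine hull {v} = {}"
      by (rule disjoint_affine_hull[OF indep4[OF v]]) (use ov[OF v] in auto)
    then show ?thesis by (auto simp: hull_inc)
  qed
  have indepS: "\<not> affine_dependent {o', p, q}"
  proof -
    obtain v where v: "v \<in> T" using T(1) by fastforce
    show ?thesis
      by (rule contrapos_nn[OF indep4[OF v]], erule affine_dependent_subset) auto
  qed
  have edges: "convex hull {a, b} \<inter> convex hull (T - {v}) = {}"
    if ab: "a = o' \<and> b = p \<or> a = o' \<and> b = q \<or> a = p \<and> b = q" and v: "v \<in> T" for a b v
  proof -
    have c2: "card (T - {v}) = 2" using T(1) v by simp
    then have c3: "card (insert a (T - {v})) \<le> 3" using fin by (simp add: card_insert_if)
    have a: "\<not> affine_dependent (insert a (T - {v}))" using sub[of "T - {v}"] ab c2 by auto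
    have "generic (insert a T) b" using ab p generic_mono[OF q, of "insert a T"] by auto
    then have ind: "\<not> affine_dependent (insert b (insert a (T - {v})))"
      by (rule affine_independent_insert_generic[OF a]) (use c3 in auto)
    have "affine hull {a, b} \<inter> affine hull (T - {v}) = {}"
      by (rule disjoint_affine_hull[OF ind]) (use ov ab in auto)
    then show ?thesis using convex_hull_subset_affine_hull by blast
  qed
  let ?S = "{o', p, q}"
  have diffs: "?S - {o'} = {p, q}" "?S - {p} = {o', q}" "?S - {q} = {o', p}" using ne by auto
  have "(\<Sum>a\<in>?S. of_bool (convex hull (?S - {a}) \<inter> convex hull T \<noteq> {}))
       + (\<Sum>v\<in>T. of_bool (convex hull (T - {v}) \<inter> convex hull ?S \<noteq> {})) = (0::bit)"
  proof (rule independent_triangles_crossing_parity)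
    show "card ?S = 3" using ne by simp
    show "\<not> affine_dependent ?S" by (fact indepS)
    show "a \<notin> affine hull T" if "a \<in> ?S" for a
      using that T fin genericD[OF o, of T] genericD[OF p, of T] genericD[OF q, of T] by auto
    show "convex hull (?S - {a}) \<inter> convex hull (T - {v}) = {}" if a: "a \<in> ?S" and v: "v \<in> T" for a v
    proof -
      consider "a = o'" | "a = p" | "a = q" using a by blast
      then show ?thesis
      proof cases
        case 1 then show ?thesis using edges[OF _ v, of p q] diffs(1) by simp
      next
        case 2 then show ?thesis using edges[OF _ v, of o' q] diffs(2) by simp
      next
        case 3 then show ?thesis using edges[OF _ v, of o' p] diffs(3) by simp
      qed
    qed
  qed (use T offS in auto)
  then have "of_bool (convex hull {p, q} \<inter> convex hull T \<noteq> {}) + of_bool (convex hull {o', q} \<inter> convex hull T \<noteq> {})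
    + of_bool (convex hull {o', p} \<inter> convex hull T \<noteq> {})
    = (\<Sum>v\<in>T. of_bool (convex hull (T - {v}) \<inter> convex hull ?S \<noteq> {}) :: bit)"
    unfolding sum_triple[of ?S o' p q, OF refl ne] diffs by (rule bit_add_eq_0)
  then show ?thesis
    unfolding segment_convex_hull by (simp only: add.commute add.left_commute)
qed

text \<open>Here \<open>x\<close> and \<open>t * x\<close> are the heights of two points over a
  plane, on the same side of it; the segment between them stays there. The final factor
  \<open>x\<close> treats both signs at once.\<close>

lemma segment_same_sign:
  fixes x t w :: real
  assumes "0 < t" "0 \<le> w" "w \<le> 1" "x \<noteq> 0"
  shows "((1 - w) * x + w * (t * x)) * x > 0"
proof -
  have "((1 - w) * x + w * (t * x)) * x = ((1 - w) + w * t) * (x * x)"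
    by (simp add: algebra_simps)
  moreover have "(1 - w) + w * t > 0"
    using assms by (cases "w = 1") (auto intro: add_pos_nonneg)
  moreover have "x * x > 0" using assms(4) by (auto simp: zero_less_mult_iff)
  ultimately show ?thesis by (metis mult_pos_pos)
qed

subsection \<open>Colourings of the complement of a system of triangles\<close>

text \<open>The index type decouples the triangles in space from those of the abstract configuration,
  so that no cycle space has to be transported along the simplicial isomorphism.\<close>
locale triangle_system =
  fixes T :: "'i set" and \<tau> :: "'i \<Rightarrow> (real^3) set"
  assumes finite_T: "finite T"
    and card_\<tau>: "i \<in> T \<Longrightarrow> card (\<tau> i) = 3"
    and indep_\<tau>: "i \<in> T \<Longrightarrow> \<not> affine_dependent (\<tau> i)"
    and inj_\<tau>: "inj_on \<tau> T"
    and hull_Int: "i \<in> T \<Longrightarrow> j \<in> T \<Longrightarrow>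
      convex hull (\<tau> i) \<inter> convex hull (\<tau> j) = convex hull (\<tau> i \<inter> \<tau> j)"
begin

definition tri :: "'i \<Rightarrow> (real^3) set" where "tri i = convex hull (\<tau> i)"
definition body :: "(real^3) set" where "body = (\<Union>i\<in>T. tri i)"

text \<open>A normal vector and an offset, hence an orientation of the plane. Either orientation
  will do, since over GF(2) the jump is symmetric in the two sides.\<close>

definition plane :: "'i \<Rightarrow> (real^3) \<times> real" where
  "plane i = (SOME hk. fst hk \<noteq> 0 \<and> affine hull (\<tau> i) = {x. fst hk \<bullet> x = snd hk})"

definition height :: "'i \<Rightarrow> real^3 \<Rightarrow> real" where
  "height i x = fst (plane i) \<bullet> x - snd (plane i)"

lemma plane:
  assumes "i \<in> T"
  shows "fst (plane i) \<noteq> 0" and "affine hull (\<tau> i) = {x. height i x = 0}"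
proof -
  have "\<exists>hk. fst hk \<noteq> 0 \<and> affine hull (\<tau> i) = {x. fst hk \<bullet> x = snd hk}"
    using plane_through_triangle[OF card_\<tau>[OF assms] indep_\<tau>[OF assms]] by (metis fst_conv snd_conv)
  then have "fst (plane i) \<noteq> 0 \<and> affine hull (\<tau> i) = {x. fst (plane i) \<bullet> x = snd (plane i)}"
    unfolding plane_def by (rule someI_ex)
  then show "fst (plane i) \<noteq> 0" "affine hull (\<tau> i) = {x. height i x = 0}"
    by (simp_all add: height_def)
qed

lemma height_affine: "height i ((1 - u) *\<^sub>R a + u *\<^sub>R b) = (1 - u) * height i a + u * height i b"
  by (simp add: height_def inner_add_right algebra_simps)

lemma finite_\<tau>: "i \<in> T \<Longrightarrow> finite (\<tau> i)"
  by (simp add: indep_\<tau> aff_independent_finite)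

lemma \<tau>_nonempty: "i \<in> T \<Longrightarrow> \<tau> i \<noteq> {}"
  using card_\<tau> by fastforce

lemma compact_tri: "i \<in> T \<Longrightarrow> compact (tri i)"
  by (simp add: tri_def finite_\<tau> finite_imp_compact_convex_hull)

lemma closed_tri: "i \<in> T \<Longrightarrow> closed (tri i)"
  by (simp add: compact_tri compact_imp_closed)

lemma open_complement: "open (- body)"
  unfolding body_def by (intro open_Compl closed_UN finite_T) (simp add: closed_tri)

lemma tri_subset_plane: "i \<in> T \<Longrightarrow> x \<in> tri i \<Longrightarrow> height i x = 0"
  using convex_hull_subset_affine_hull[of "\<tau> i"] plane(2)[of i] by (auto simp: tri_def)

lemma affine_hull_tri: "affine hull (tri i) = affine hull (\<tau> i)"
  by (simp add: tri_def)

lemma rel_interior_tri: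
  assumes "i \<in> T"
  shows "rel_interior (tri i) = tri i - (\<Union>v\<in>\<tau> i. convex hull (\<tau> i - {v}))"
proof -
  have "rel_frontier (tri i) = (\<Union>v\<in>\<tau> i. convex hull (\<tau> i - {v}))"
    unfolding tri_def rel_frontier_convex_hull_cases[OF indep_\<tau>[OF assms]] by blast
  moreover have "rel_frontier (tri i) = tri i - rel_interior (tri i)"
    using closed_tri[OF assms] by (simp add: rel_frontier_def)
  ultimately show ?thesis using rel_interior_subset[of "tri i"] by blast
qed

text \<open>The vertex triples are distinct and of equal size, so their intersection omits a vertex
  of the first one; the common face then lies in a side of triangle \<open>i\<close>, outside its
  relative interior.\<close>

lemma rel_interior_notin_tri:
  assumes "i \<in> T" "j \<in> T" "i \<noteq> j" "q \<in> rel_interior (tri i)"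
  shows "q \<notin> tri j"
proof
  assume "q \<in> tri j"
  then have q: "q \<in> convex hull (\<tau> i \<inter> \<tau> j)"
    using assms hull_Int rel_interior_subset unfolding tri_def by blast
  have "\<not> \<tau> i \<subseteq> \<tau> j"
    using assms inj_\<tau> card_\<tau> finite_\<tau> by (metis card_subset_eq inj_onD)
  then obtain v where v: "v \<in> \<tau> i" "\<tau> i \<inter> \<tau> j \<subseteq> \<tau> i - {v}" by blast
  then have "q \<in> convex hull (\<tau> i - {v})" using q hull_mono by blast
  then show False using assms v rel_interior_tri by blast
qed

text \<open>Inside a nice ball the body is a flat disc, so the two half balls lie in its complement.\<close>
definition nice :: "'i \<Rightarrow> real^3 \<Rightarrow> real \<Rightarrow> bool" where
  "nice i q r \<longleftrightarrow> r > 0 \<and> q \<in> rel_interior (tri i) \<and> (\<forall>j\<in>T. j \<noteq> i \<longrightarrow> ball q r \<inter> tri j = {})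
     \<and> ball q r \<inter> affine hull (\<tau> i) \<subseteq> tri i"

lemma nice_exists:
  assumes "i \<in> T" "q \<in> rel_interior (tri i)"
  obtains r where "nice i q r"
proof -
  obtain e where e: "e > 0" "ball q e \<inter> affine hull (\<tau> i) \<subseteq> tri i"
    using assms(2) unfolding mem_rel_interior_ball affine_hull_tri by blast
  have "closed (\<Union>j\<in>T - {i}. tri j)" using finite_T closed_tri by blast
  then have "open (- (\<Union>j\<in>T - {i}. tri j))" by (rule open_Compl)
  moreover have "q \<in> - (\<Union>j\<in>T - {i}. tri j)"
    using rel_interior_notin_tri[OF assms(1) _ _ assms(2)] by blast
  ultimately obtain d where d: "d > 0" "ball q d \<subseteq> - (\<Union>j\<in>T - {i}. tri j)"
    using open_contains_ball by meson
  have "ball q (min e d) \<subseteq> ball q e" "ball q (min e d) \<subseteq> ball q d" by auto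
  then have "nice i q (min e d)"
    unfolding nice_def using e d assms(2) by (intro conjI) (simp, simp, blast, blast)
  then show ?thesis by (rule that)
qed

lemma nice_ball_body:
  assumes "i \<in> T" "nice i q r" "p \<in> ball q r"
  shows "p \<in> body \<longleftrightarrow> height i p = 0"
proof
  assume "p \<in> body"
  then obtain j where j: "j \<in> T" "p \<in> tri j" by (auto simp: body_def)
  then have "j = i" using assms(2,3) unfolding nice_def by blast
  then show "height i p = 0" using j tri_subset_plane by blast
next
  assume "height i p = 0"
  then have "p \<in> affine hull (\<tau> i)" using plane(2)[OF assms(1)] by simp
  then have "p \<in> tri i" using assms(2,3) unfolding nice_def by blast
  then show "p \<in> body" using assms(1) by (auto simp: body_def)
qed

text \<open>A representative of the cell that touches triangle \<open>i\<close> on the side given by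
  the sign of \<open>s\<close>. That this cell does not depend on the choice is the content of
  \<open>half_balls_connected\<close>.\<close>

definition side :: "'i \<Rightarrow> real \<Rightarrow> real^3" where
  "side i s = (SOME p. \<exists>q r. nice i q r \<and> p \<in> ball q r \<and> s * height i p > 0)"

lemma open_half_ball: "open {p \<in> ball q r. s * height i p > 0}"
proof -
  have "{p \<in> ball q r. s * height i p > 0} = ball q r \<inter> {p. 0 < s * height i p}" by auto
  moreover have "open {p. 0 < s * height i p}"
    unfolding height_def by (intro open_Collect_less continuous_intros)
  ultimately show ?thesis by (simp add: open_Int)
qed

text \<open>The factor \<open>s\<close> in the displacement along the normal makes
  \<open>s * height i\<close> a positive multiple of \<open>s * s\<close>, so the point is on the
  correct side for either sign.\<close>

lemma half_ball_offset:
  assumes "i \<in> T" "nice i q r" "s \<noteq> 0" "\<epsilon> > 0" "\<epsilon> * \<bar>s\<bar> * norm (fst (plane i)) < r"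
  shows "q + (\<epsilon> * s) *\<^sub>R fst (plane i) \<in> {p \<in> ball q r. s * height i p > 0}"
proof -
  have "height i q = 0" using assms tri_subset_plane rel_interior_subset unfolding nice_def by blast
  then have e: "s * height i (q + (\<epsilon> * s) *\<^sub>R fst (plane i)) = \<epsilon> * (s * s) * (fst (plane i) \<bullet> fst (plane i))"
    by (simp add: height_def inner_add_right algebra_simps)
  have "fst (plane i) \<bullet> fst (plane i) > 0" using plane(1)[OF assms(1)] by simp
  moreover have "s * s > 0" using assms(3) by (auto simp: zero_less_mult_iff)
  ultimately have "s * height i (q + (\<epsilon> * s) *\<^sub>R fst (plane i)) > 0"
    unfolding e using assms(4) mult_pos_pos by metis
  moreover have "q + (\<epsilon> * s) *\<^sub>R fst (plane i) \<in> ball q r"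
    using assms(4,5) by (simp add: dist_norm abs_mult)
  ultimately show ?thesis by simp
qed

lemma half_ball_connected:
  assumes "i \<in> T" "nice i q r" "p \<in> ball q r" "p' \<in> ball q r" "s * height i p > 0" "s * height i p' > 0"
  shows "connected_component (- body) p p'"
proof -
  let ?H = "{p \<in> ball q r. s * height i p > 0}"
  have "?H = ball q r \<inter> {x. (s *\<^sub>R fst (plane i)) \<bullet> x > s * snd (plane i)}"
    by (auto simp: height_def algebra_simps)
  then have "convex ?H" by (simp only: convex_Int convex_ball convex_halfspace_gt)
  then have "connected ?H" by (rule convex_connected)
  moreover have "?H \<subseteq> - body" using nice_ball_body[OF assms(1,2)] by auto
  ultimately show ?thesis unfolding connected_component_def using assms by blast
qed

text \<open>The segment from \<open>q\<close> to \<open>q'\<close> runs inside the open triangle and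
  has positive distance from all other triangles. Pushed a little along the normal, it leaves its
  own plane, reaches no other triangle, and joins the two half balls.\<close>

lemma half_balls_connected:
  assumes i: "i \<in> T" and q: "nice i q r" and q': "nice i q' r'" and s: "s \<noteq> 0"
    and p: "p \<in> ball q r" "s * height i p > 0" and p': "p' \<in> ball q' r'" "s * height i p' > 0"
  shows "connected_component (- body) p p'"
proof -
  let ?n = "fst (plane i)" and ?O = "\<Union>j\<in>T - {i}. tri j" and ?K = "closed_segment q q'"
  have K: "?K \<subseteq> rel_interior (tri i)"
    using q q' unfolding nice_def by (intro closed_segment_subset convex_rel_interior) (auto simp: tri_def)
  have "?K \<inter> ?O = {}" using K rel_interior_notin_tri[OF i] by blast
  moreover have "closed ?O" using finite_T closed_tri by blast
  ultimately have "\<exists>d>0. \<forall>x\<in>?K. \<forall>y\<in>?O. d \<le> dist x y"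
    by (intro separate_compact_closed compact_segment)
  then obtain d where d: "d > 0" "\<And>x y. x \<in> ?K \<Longrightarrow> y \<in> ?O \<Longrightarrow> d \<le> dist x y"
    by blast
  define m where "m = Min {d, r, r'}"
  have m: "m > 0" "m \<le> d" "m \<le> r" "m \<le> r'" using d q q' by (auto simp: m_def nice_def)
  define c where "c = \<bar>s\<bar> * norm ?n"
  have c: "c > 0" using s plane(1)[OF i] by (simp add: c_def)
  \<comment> \<open>The displacement gets length \<open>m / 2\<close>, which is below both radii and
    below the distance to the other triangles.\<close>
  define \<epsilon> where "\<epsilon> = m / (2 * c)"
  have \<epsilon>: "\<epsilon> > 0" "\<epsilon> * \<bar>s\<bar> * norm ?n < m"
    using m c by (auto simp: \<epsilon>_def mult.assoc c_def[symmetric])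
  let ?g = "\<lambda>z. z + (\<epsilon> * s) *\<^sub>R ?n"
  have "connected (?g ` ?K)" by (intro connected_continuous_image continuous_intros connected_segment)
  moreover have "?g ` ?K \<subseteq> - body"
  proof
    fix y assume "y \<in> ?g ` ?K"
    then obtain z where z: "z \<in> ?K" "y = ?g z" by blast
    have "y \<in> tri j \<Longrightarrow> False" if "j \<in> T" for j
    proof -
      assume y: "y \<in> tri j"
      show False
      proof (cases "j = i")
        case True
        have "height i z = 0" using z K rel_interior_subset tri_subset_plane[OF i] by blast
        then have "height i y = \<epsilon> * s * (?n \<bullet> ?n)"
          unfolding z by (simp add: height_def inner_add_right)
        then show False using True y tri_subset_plane[OF i] \<epsilon> s plane(1)[OF i] by auto
      next
        case False
        then have "d \<le> dist z y" using d(2) z y that by blast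
        then show False using \<epsilon> m z by (simp add: dist_norm abs_mult)
      qed
    qed
    then show "y \<in> - body" by (auto simp: body_def)
  qed
  ultimately have 1: "connected_component (- body) (?g q) (?g q')"
    unfolding connected_component_def by blast
  have g: "?g q \<in> {p \<in> ball q r. s * height i p > 0}" "?g q' \<in> {p \<in> ball q' r'. s * height i p > 0}"
    using half_ball_offset[OF i q s \<epsilon>(1)] half_ball_offset[OF i q' s \<epsilon>(1)] \<epsilon> m by linarith+
  have "connected_component (- body) p (?g q)" "connected_component (- body) (?g q') p'"
    using half_ball_connected[OF i q, of p "?g q" s] half_ball_connected[OF i q', of "?g q'" p' s] p p' g by auto
  then show ?thesis using 1 connected_component_trans by metis
qed

lemma nice_nonempty:
  assumes "i \<in> T" obtains q r where "nice i q r"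
proof -
  have "rel_interior (tri i) \<noteq> {}"
    using \<tau>_nonempty[OF assms] by (simp add: tri_def rel_interior_eq_empty)
  then show ?thesis using nice_exists[OF assms] that by blast
qed

lemma half_ball_nonempty:
  assumes "i \<in> T" "nice i q r" "s \<noteq> 0"
  shows "{p \<in> ball q r. s * height i p > 0} \<noteq> {}"
proof -
  have c: "\<bar>s\<bar> * norm (fst (plane i)) > 0" using assms plane(1)[OF assms(1)] by simp
  have r: "r > 0" using assms by (simp add: nice_def)
  define \<epsilon> where "\<epsilon> = r / (2 * (\<bar>s\<bar> * norm (fst (plane i))))"
  have "\<epsilon> * (\<bar>s\<bar> * norm (fst (plane i))) = r / 2" using c unfolding \<epsilon>_def by auto
  then have "\<epsilon> > 0" "\<epsilon> * \<bar>s\<bar> * norm (fst (plane i)) < r"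
    using c r by (simp_all add: \<epsilon>_def mult.assoc)
  from half_ball_offset[OF assms this] show ?thesis by blast
qed

lemma connected_to_side:
  assumes "i \<in> T" "nice i q r" "s \<noteq> 0" "p \<in> ball q r" "s * height i p > 0"
  shows "connected_component (- body) p (side i s)"
proof -
  have "\<exists>q r. nice i q r \<and> side i s \<in> ball q r \<and> s * height i (side i s) > 0"
    unfolding side_def by (rule someI_ex) (use assms in blast)
  then show ?thesis using half_balls_connected[OF assms(1,2) _ assms(3,4,5)] by blast
qed

text \<open>The relation \<open>connected_component (- body)\<close> holds only between points of
  the complement, so the values on the body are arbitrary.\<close>

definition colouring :: "(real^3 \<Rightarrow> bit) \<Rightarrow> bool" where
  "colouring f \<longleftrightarrow> (\<forall>p q. connected_component (- body) p q \<longrightarrow> f p = f q)"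

definition jump :: "(real^3 \<Rightarrow> bit) \<Rightarrow> 'i \<Rightarrow> bit" where
  "jump f i = f (side i 1) + f (side i (- 1))"

lemma colouring_across:
  assumes f: "colouring f" and i: "i \<in> T" "nice i q r" and p: "p \<in> ball q r" "p' \<in> ball q r"
    and opp: "height i p * height i p' < 0"
  shows "f p + f p' = jump f i"
proof -
  have up: "f z = f (side i 1)" if "z \<in> ball q r" "height i z > 0" for z
    using connected_to_side[OF i, of 1 z] that f by (auto simp: colouring_def)
  have down: "f z = f (side i (-1))" if "z \<in> ball q r" "height i z < 0" for z
    using connected_to_side[OF i, of "-1" z] that f by (auto simp: colouring_def)
  have "height i p > 0 \<and> height i p' < 0 \<or> height i p < 0 \<and> height i p' > 0"
    using opp by (auto simp: mult_less_0_iff)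
  then show ?thesis using up down p by (auto simp: jump_def add.commute)
qed

definition hits :: "real^3 \<Rightarrow> real^3 \<Rightarrow> 'i set" where
  "hits a b = {i \<in> T. closed_segment a b \<inter> tri i \<noteq> {}}"

lemma finite_hits: "finite (hits a b)"
  using finite_T by (simp add: hits_def)

text \<open>The last assumption is the transversality that survives passing to subsegments; requiring
  the end points to avoid all planes would not.\<close>
lemma colouring_along_segment:
  assumes f: "colouring f"
  shows "a \<notin> body \<Longrightarrow> b \<notin> body \<Longrightarrow>
    (\<And>i v. i \<in> T \<Longrightarrow> v \<in> \<tau> i \<Longrightarrow> closed_segment a b \<inter> convex hull (\<tau> i - {v}) = {}) \<Longrightarrow>
    (\<And>i. i \<in> hits a b \<Longrightarrow> height i a \<noteq> height i b) \<Longrightarrow>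
    f a + f b = sum (jump f) (hits a b)"
\<comment> \<open>A short piece around one crossing point is cut out. The two outer pieces hit fewer
  triangles, and the short piece changes the colour by the jump at the triangle crossed.\<close>
proof (induction "card (hits a b)" arbitrary: a b rule: less_induct)
  case less
  note ab = less.prems(1,2) and edges = less.prems(3) and trans = less.prems(4)
  show ?case
  proof (cases "hits a b = {}")
    case True
    then have "closed_segment a b \<subseteq> - body" by (auto simp: hits_def body_def)
    then have "connected_component (- body) a b"
      unfolding connected_component_def using connected_segment by blast
    then have "f a = f b" using f by (simp add: colouring_def)
    then show ?thesis using True by (simp add: bit_add_self)
  next
    case False
    then obtain i q where i: "i \<in> hits a b" and q: "q \<in> closed_segment a b" "q \<in> tri i"
      by (auto simp: hits_def)
    have iT: "i \<in> T" using i by (simp add: hits_def)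
    have "q \<in> rel_interior (tri i)" using q edges[OF iT] rel_interior_tri[OF iT] by blast
    then obtain r where r: "nice i q r" using nice_exists[OF iT] by blast
    have q_body: "q \<in> body" using q iT by (auto simp: body_def)
    then have qab: "q \<noteq> a" "q \<noteq> b" using ab by auto
    have hq: "height i q = 0" using q tri_subset_plane[OF iT] by blast
    obtain u where u: "0 \<le> u" "u \<le> 1" "q = (1 - u) *\<^sub>R a + u *\<^sub>R b"
      using q(1) unfolding in_segment by blast
    have u01: "0 < u" "u < 1" using u qab by (auto simp: less_le)
    have hab: "(1 - u) * height i a + u * height i b = 0" using hq u height_affine by simp
    \<comment> \<open>The height is affine on the segment and zero at the inner point
      \<open>q\<close>, but not constant by \<open>trans\<close>; hence the ends lie on opposite
      sides.\<close>
    have opp: "height i a * height i b < 0"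
    proof -
      have ha: "height i a = - (u / (1 - u)) * height i b"
        using hab u01 by (simp add: field_simps)
      have "height i b \<noteq> 0" using ha trans[OF i] by auto
      then have "height i b * height i b > 0" by (auto simp: zero_less_mult_iff)
      moreover have "u / (1 - u) > 0" using u01 by simp
      ultimately have "u / (1 - u) * (height i b * height i b) > 0" by (rule mult_pos_pos[rotated])
      then show ?thesis unfolding ha by (simp add: mult.assoc)
    qed
    define N where "N = norm (a - q) + norm (b - q)"
    have N: "N > 0" unfolding N_def using qab by (intro add_pos_pos) simp_all
    have r0: "r > 0" using r by (simp add: nice_def)
    \<comment> \<open>The second bound brings both \<open>a'\<close> and \<open>b'\<close> into the
      nice ball; the first keeps \<open>t\<close> below 1.\<close>
    define t where "t = min (1/2) (r / (2 * N))"
    have "r / (2 * N) > 0" using N r0 by simp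
    then have t: "0 < t" "t < 1" unfolding t_def by linarith+
    have "t * (norm (a - q) + norm (b - q)) \<le> r / (2 * N) * N"
      unfolding N_def[symmetric] using N by (intro mult_right_mono) (auto simp: t_def)
    also have "\<dots> = r / 2" using N by simp
    finally have "t * norm (a - q) + t * norm (b - q) < r" using r0 by (simp add: distrib_left)
    moreover have "t * norm (a - q) \<ge> 0" "t * norm (b - q) \<ge> 0" using t by auto
    ultimately have tn: "t * norm (a - q) < r" "t * norm (b - q) < r" by linarith+
    define a' b' where "a' = (1 - t) *\<^sub>R q + t *\<^sub>R a" and "b' = (1 - t) *\<^sub>R q + t *\<^sub>R b"
    have a'_eq: "a' - q = t *\<^sub>R (a - q)" and b'_eq: "b' - q = t *\<^sub>R (b - q)"
      by (simp_all add: a'_def b'_def algebra_simps)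
    have ball: "a' \<in> ball q r" "b' \<in> ball q r"
      using tn t a'_eq b'_eq by (simp_all add: dist_norm norm_minus_commute[of q])
    have ha': "height i a' = t * height i a" and hb': "height i b' = t * height i b"
      by (simp_all add: a'_def b'_def height_affine hq)
    have a'_in: "a' \<in> closed_segment a q" and b'_in: "b' \<in> closed_segment q b"
      using t unfolding a'_def b'_def closed_segment_commute[of a q] in_segment
      by (auto intro!: exI[of _ t])
    have seg_a: "closed_segment a q = closed_segment a a' \<union> closed_segment a' q"
      using Un_closed_segment[OF a'_in] by simp
    have seg_b: "closed_segment q b = closed_segment q b' \<union> closed_segment b' b"
      using Un_closed_segment[OF b'_in] by simp
    have seg: "closed_segment a b = closed_segment a a' \<union> closed_segment a' q \<union> (closed_segment q b' \<union> closed_segment b' b)"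
      using Un_closed_segment[OF q(1)] seg_a seg_b by simp
    have sgn_a: "height i z * height i a > 0" if z: "z \<in> closed_segment a a'" for z
    proof -
      obtain w where w: "0 \<le> w" "w \<le> 1" "z = (1 - w) *\<^sub>R a + w *\<^sub>R a'"
        using z unfolding in_segment by blast
      have "height i a \<noteq> 0" using opp by (metis mult_zero_left mult_zero_right less_irrefl)
      then show ?thesis
        unfolding w(3) height_affine ha' using t w by (intro segment_same_sign)
    qed
    have sgn_b: "height i z * height i b > 0" if z: "z \<in> closed_segment b' b" for z
    proof -
      obtain w where w: "0 \<le> w" "w \<le> 1" "z = (1 - w) *\<^sub>R b + w *\<^sub>R b'"
        using z unfolding closed_segment_commute[of b'] in_segment by blast
      have "height i b \<noteq> 0" using opp by (metis mult_zero_left mult_zero_right less_irrefl)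
      then show ?thesis
        unfolding w(3) height_affine hb' using t w by (intro segment_same_sign)
    qed
    have middle: "z = q" if z: "z \<in> closed_segment a' q \<union> closed_segment q b'" "z \<in> body" for z
    proof -
      have "z \<in> ball q r"
        using z ball r0 closed_segment_subset[of a' "ball q r" q] closed_segment_subset[of q "ball q r" b'] by auto
      then have hz: "height i z = 0" using nice_ball_body[OF iT r] z by blast
      have 0: "height i a' \<noteq> 0" "height i b' \<noteq> 0" using ha' hb' t opp by auto
      obtain c where c: "c = a' \<or> c = b'" "z \<in> closed_segment q c"
        using z(1) unfolding closed_segment_commute[of a' q] by blast
      then obtain w where w: "z = (1 - w) *\<^sub>R q + w *\<^sub>R c"
        unfolding in_segment by blast
      then have "w * height i c = 0" using hz hq height_affine by simp
      then show "z = q" using w c(1) 0 by (auto simp: algebra_simps)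
    qed
    \<comment> \<open>By \<open>middle\<close> the inner piece meets the body only at
      \<open>q\<close>, and \<open>q\<close>, a relative interior point, lies in no triangle but
      \<open>i\<close>.\<close>
    have split: "hits a b = insert i (hits a a' \<union> hits b' b)"
    proof
      show "hits a b \<subseteq> insert i (hits a a' \<union> hits b' b)"
      proof
        fix j assume "j \<in> hits a b"
        then obtain z where j: "j \<in> T" and z: "z \<in> closed_segment a b" "z \<in> tri j" by (auto simp: hits_def)
        show "j \<in> insert i (hits a a' \<union> hits b' b)"
        proof (cases "z \<in> closed_segment a' q \<union> closed_segment q b'")
          case True
          then have "z = q" using middle z j by (auto simp: body_def)
          then have "j = i" using rel_interior_notin_tri[OF iT j] z \<open>q \<in> rel_interior (tri i)\<close> by blast
          then show ?thesis by simp
        next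
          case False
          then show ?thesis using z j seg by (auto simp: hits_def)
        qed
      qed
      show "insert i (hits a a' \<union> hits b' b) \<subseteq> hits a b"
        using i seg by (auto simp: hits_def)
    qed
    have i_out: "i \<notin> hits a a'" "i \<notin> hits b' b"
      using sgn_a sgn_b tri_subset_plane[OF iT] by (force simp: hits_def)+
    \<comment> \<open>A triangle hit in both outer pieces would give its height two zeros on the
      segment. By \<open>trans\<close> these coincide, but the outer pieces lie on different sides
      of plane \<open>i\<close>.\<close>
    have disj: "hits a a' \<inter> hits b' b = {}"
    proof (rule ccontr)
      assume "hits a a' \<inter> hits b' b \<noteq> {}"
      then obtain j where j': "j \<in> hits a a'" "j \<in> hits b' b" by blast
      then obtain z1 z2 where z1: "z1 \<in> closed_segment a a'" "z1 \<in> tri j"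
        and z2: "z2 \<in> closed_segment b' b" "z2 \<in> tri j"
        unfolding hits_def by blast
      have j: "j \<in> T" "j \<in> hits a b" using j' split by (auto simp: hits_def)
      have "z1 \<in> closed_segment a b" "z2 \<in> closed_segment a b" using z1 z2 seg by auto
      then obtain w1 w2 where w: "z1 = (1 - w1) *\<^sub>R a + w1 *\<^sub>R b" "z2 = (1 - w2) *\<^sub>R a + w2 *\<^sub>R b"
        unfolding in_segment by blast
      have "(1 - w1) * height j a + w1 * height j b = (1 - w2) * height j a + w2 * height j b"
        using tri_subset_plane[OF j(1)] z1 z2 w height_affine by metis
      then have "(w1 - w2) * (height j b - height j a) = 0" by (simp add: algebra_simps)
      then have "z1 = z2" using trans[OF j(2)] w by auto
      then have "height i z1 * height i a > 0" "height i z1 * height i b > 0"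
        using sgn_a[OF z1(1)] sgn_b[of z1] z2 by auto
      then show False using opp by (auto simp: zero_less_mult_iff mult_less_0_iff)
    qed
    have less_card: "card (hits a a') < card (hits a b)" "card (hits b' b) < card (hits a b)"
      using i i_out split by (intro psubset_card_mono finite_hits; blast)+
    have off: "a' \<notin> body" "b' \<notin> body"
      using nice_ball_body[OF iT r] ball ha' hb' t opp by auto
    have param: "a' = (1 - (1 - t) * u) *\<^sub>R a + ((1 - t) * u) *\<^sub>R b"
      "b' = (1 - ((1 - t) * u + t)) *\<^sub>R a + ((1 - t) * u + t) *\<^sub>R b"
      unfolding a'_def b'_def u(3) by (simp_all add: algebra_simps)
    \<comment> \<open>The heights at the ends of an outer piece differ by a nonzero multiple of the
      original difference, so the transversality assumption is inherited.\<close>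
    have hj: "height j a \<noteq> height j a'" "height j b' \<noteq> height j b" if "height j a \<noteq> height j b" for j
    proof -
      have "height j a' - height j a = (1 - t) * u * (height j b - height j a)"
        "height j b' - height j b = (1 - t) * (1 - u) * (height j a - height j b)"
        unfolding param height_affine by (simp_all add: algebra_simps)
      then show "height j a \<noteq> height j a'" "height j b' \<noteq> height j b"
        using that t u01 by auto
    qed
    have "f a + f a' = sum (jump f) (hits a a')"
    proof (rule less.hyps[OF less_card(1) ab(1) off(1)])
      show "closed_segment a a' \<inter> convex hull (\<tau> i - {v}) = {}" if "i \<in> T" "v \<in> \<tau> i" for i v
        using edges[OF that] seg by blast
      show "height j a \<noteq> height j a'" if "j \<in> hits a a'" for j
        using hj(1) trans[of j] that split by blast
    qed
    moreover have "f b' + f b = sum (jump f) (hits b' b)"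
    proof (rule less.hyps[OF less_card(2) off(2) ab(2)])
      show "closed_segment b' b \<inter> convex hull (\<tau> i - {v}) = {}" if "i \<in> T" "v \<in> \<tau> i" for i v
        using edges[OF that] seg by blast
      show "height j b' \<noteq> height j b" if "j \<in> hits b' b" for j
        using hj(2) trans[of j] that split by blast
    qed
    moreover have "f a' + f b' = jump f i"
    proof (rule colouring_across[OF f iT r ball])
      show "height i a' * height i b' < 0"
        using opp t unfolding ha' hb' by (auto simp: mult_less_0_iff zero_less_mult_iff)
    qed
    moreover have "sum (jump f) (hits a b) = jump f i + (sum (jump f) (hits a a') + sum (jump f) (hits b' b))"
      unfolding split using i_out disj finite_hits by (simp add: sum.union_disjoint)
    moreover have "f a + f b = (f a' + f b') + ((f a + f a') + (f b' + f b))"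
      by (cases "f a'"; cases "f b'"; cases "f a"; cases "f b") auto
    ultimately show ?thesis by simp
  qed
qed

end

section \<open>Jumps of colourings are cycles\<close>

lemma affine_combination_3:
  fixes a b c :: "'a::real_vector"
  assumes "u + v + w = 1"
  shows "u *\<^sub>R a + v *\<^sub>R b + w *\<^sub>R c \<in> affine hull {a, b, c}"
  using assms unfolding affine_hull_3 by blast

lemma two_subset_of_three:
  assumes "E \<subseteq> S" "card E = 2" "card S = 3"
  obtains v where "v \<in> S" "E = S - {v}"
proof -
  have "finite S" using assms(3) card.infinite by fastforce
  then have "card (S - E) = 1"
    using assms card_Diff_subset[of E S] finite_subset[of E S] by simp
  then obtain v where "S - E = {v}" by (auto simp: card_1_singleton_iff)
  then have "v \<in> S" "E = S - {v}" using assms(1) by auto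
  then show ?thesis by (rule that)
qed

text \<open>The midpoint of an edge is a relative interior point of it, so every face of the simplex
  that contains the midpoint contains the edge.\<close>

lemma midpoint_in_hull_subset:
  fixes S :: "'a::euclidean_space set"
  assumes S: "\<not> affine_dependent S" and E: "{v, w} \<subseteq> S" "v \<noteq> w" and G: "G \<subseteq> S" "midpoint v w \<in> convex hull G"
  shows "{v, w} \<subseteq> G"
proof -
  have ind: "\<not> affine_dependent (G \<union> {v, w})"
    using S E(1) G(1) affine_dependent_subset by (metis Un_least)
  have "midpoint v w \<in> convex hull {v, w}" by (simp flip: segment_convex_hull)
  then have m: "midpoint v w \<in> convex hull (G \<inter> {v, w})"
    using convex_hull_Int_subset[OF ind] G(2) by blast
  show ?thesis
  proof (rule ccontr)
    assume "\<not> {v, w} \<subseteq> G"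
    then have "G \<inter> {v, w} \<subseteq> {v} \<or> G \<inter> {v, w} \<subseteq> {w}" by blast
    then have "midpoint v w \<in> convex hull {v} \<or> midpoint v w \<in> convex hull {w}"
      using m hull_mono by blast
    then show False using E(2) by simp
  qed
qed

text \<open>A segment with an end off the plane meets the plane at most once. This pins down where
  an edge can meet the small triangle around its midpoint.\<close>

lemma midpoint_unique_on_plane:
  fixes h :: "'a::euclidean_space"
  assumes "z \<in> convex hull {v, w}" "h \<bullet> z = k" "h \<bullet> midpoint v w = k" "h \<bullet> v \<noteq> k"
  shows "z = midpoint v w"
proof -
  obtain a b where z: "a + b = 1" "z = a *\<^sub>R v + b *\<^sub>R w"
    using assms(1) unfolding convex_hull_2 by blast
  have m: "h \<bullet> w = 2 * k - h \<bullet> v" using assms(3) by (simp add: midpoint_def inner_add_right)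
  have "a * (h \<bullet> v) + b * (2 * k - h \<bullet> v) = k" using assms(2) by (simp add: z(2) inner_add_right m)
  then have "(a + b) * k + (a - b) * (h \<bullet> v - k) = k" by (simp add: algebra_simps)
  then have "a = b" using z(1) assms(4) by simp
  then have ab: "a = 1/2" "b = 1/2" using z(1) by auto
  show ?thesis unfolding z(2) ab midpoint_def by (simp add: scaleR_add_right)
qed

text \<open>All barycentric coordinates of the centroid are positive, so it is in the relative
  interior.\<close>

lemma centroid_notin_edge:
  fixes a b c :: "'a::euclidean_space"
  assumes ind: "\<not> affine_dependent {a, b, c}" and ne: "a \<noteq> b" "a \<noteq> c" "b \<noteq> c" and s: "s \<in> {a, b, c}"
  shows "(1/3) *\<^sub>R (a + b + c) \<notin> convex hull ({a, b, c} - {s})"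
proof -
  have "(1/3) *\<^sub>R (a + b + c) \<in> rel_interior (convex hull {a, b, c})"
    unfolding rel_interior_convex_hull_explicit[OF ind] mem_Collect_eq
    by (rule exI[of _ "\<lambda>_. 1/3"]) (use ne in \<open>simp add: scaleR_add_right add.assoc\<close>)
  then have "(1/3) *\<^sub>R (a + b + c) \<notin> rel_frontier (convex hull {a, b, c})"
    by (simp add: rel_frontier_def)
  then show ?thesis unfolding rel_frontier_convex_hull_cases[OF ind] using s by blast
qed

context triangle_system
begin

text \<open>The coefficient at \<open>E\<close> of the simplicial boundary of the chain
  \<open>x\<close>, edges being given by their vertex pairs. A pair contained in no triangle gets an
  empty sum, so conditions may range over all pairs.\<close>

definition boundary :: "('i \<Rightarrow> bit) \<Rightarrow> (real^3) set \<Rightarrow> bit" where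
  "boundary x E = sum x {i \<in> T. E \<subseteq> \<tau> i}"

definition verts :: "(real^3) set" where "verts = (\<Union>i\<in>T. \<tau> i)"

lemma finite_verts: "finite verts"
  using finite_T finite_\<tau> by (simp add: verts_def)

text \<open>Double counting of the pairs of a triangle and one of its sides. It turns a count over
  sides into one weighted by boundary coefficients, which vanish for a cycle.\<close>

lemma sum_edges_swap:
  "(\<Sum>i\<in>T. x i * (\<Sum>v\<in>\<tau> i. g (\<tau> i - {v}))) = (\<Sum>E | E \<subseteq> verts \<and> card E = 2. g E * boundary x E)"
proof -
  let ?P = "{E. E \<subseteq> verts \<and> card E = 2}"
  have fin: "finite ?P" using finite_verts by simp
  have "(\<Sum>v\<in>\<tau> i. g (\<tau> i - {v})) = (\<Sum>E | E \<in> ?P \<and> E \<subseteq> \<tau> i. g E)" if i: "i \<in> T" for i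
  proof -
    have "{E. E \<in> ?P \<and> E \<subseteq> \<tau> i} = (\<lambda>v. \<tau> i - {v}) ` \<tau> i"
    proof
      show "(\<lambda>v. \<tau> i - {v}) ` \<tau> i \<subseteq> {E. E \<in> ?P \<and> E \<subseteq> \<tau> i}"
        using i card_\<tau>[OF i] by (auto simp: verts_def)
      show "{E. E \<in> ?P \<and> E \<subseteq> \<tau> i} \<subseteq> (\<lambda>v. \<tau> i - {v}) ` \<tau> i"
      proof
        fix E assume E: "E \<in> {E. E \<in> ?P \<and> E \<subseteq> \<tau> i}"
        then have "E \<subseteq> \<tau> i" "card E = 2" by auto
        then obtain v where "v \<in> \<tau> i" "E = \<tau> i - {v}"
          using card_\<tau>[OF i] by (rule two_subset_of_three)
        then show "E \<in> (\<lambda>v. \<tau> i - {v}) ` \<tau> i" by blast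
      qed
    qed
    moreover have "inj_on (\<lambda>v. \<tau> i - {v}) (\<tau> i)" by (auto simp: inj_on_def)
    ultimately show ?thesis by (simp add: sum.reindex)
  qed
  then have "(\<Sum>i\<in>T. x i * (\<Sum>v\<in>\<tau> i. g (\<tau> i - {v}))) = (\<Sum>i\<in>T. \<Sum>E | E \<in> ?P \<and> E \<subseteq> \<tau> i. x i * g E)"
    by (intro sum.cong refl) (simp only: sum_distrib_left)
  also have "\<dots> = (\<Sum>E\<in>?P. \<Sum>i | i \<in> T \<and> E \<subseteq> \<tau> i. x i * g E)"
    using finite_T fin by (rule sum.swap_restrict)
  also have "\<dots> = (\<Sum>E\<in>?P. g E * boundary x E)"
    by (simp only: boundary_def sum_distrib_left mult.commute)
  finally show ?thesis .
qed

lemma sum_hits: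
  "sum x (hits a b) = (\<Sum>i\<in>T. x i * of_bool (closed_segment a b \<inter> convex hull (\<tau> i) \<noteq> {}))" for x :: "'i \<Rightarrow> bit"
proof -
  have "sum x (hits a b) = (\<Sum>i\<in>T. if closed_segment a b \<inter> tri i \<noteq> {} then x i else 0)"
    unfolding hits_def using finite_T by (rule sum.inter_filter)
  also have "\<dots> = (\<Sum>i\<in>T. x i * of_bool (closed_segment a b \<inter> convex hull (\<tau> i) \<noteq> {}))"
    by (intro sum.cong) (auto simp: tri_def)
  finally show ?thesis .
qed

text \<open>Equal heights at the ends would make the height constant along the segment; a hit would
  make that constant 0 and put \<open>a\<close> into the plane.\<close>

lemma colouring_along_generic_segment:
  assumes f: "colouring f" and a: "\<And>i. i \<in> T \<Longrightarrow> a \<notin> affine hull (\<tau> i)" and b: "\<And>i. i \<in> T \<Longrightarrow> b \<notin> affine hull (\<tau> i)"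
    and edges: "\<And>i v. i \<in> T \<Longrightarrow> v \<in> \<tau> i \<Longrightarrow> closed_segment a b \<inter> convex hull (\<tau> i - {v}) = {}"
  shows "f a + f b = sum (jump f) (hits a b)"
proof (rule colouring_along_segment[OF f _ _ edges])
  show "a \<notin> body" "b \<notin> body"
    using a b convex_hull_subset_affine_hull by (force simp: body_def tri_def)+
  show "height i a \<noteq> height i b" if i: "i \<in> hits a b" for i
  proof
    assume eq: "height i a = height i b"
    have iT: "i \<in> T" using i by (simp add: hits_def)
    obtain z where z: "z \<in> closed_segment a b" "z \<in> tri i" using i by (auto simp: hits_def)
    obtain u where "z = (1 - u) *\<^sub>R a + u *\<^sub>R b" using z(1) unfolding in_segment by blast
    then have "height i z = (1 - u) * height i a + u * height i b" by (simp only: height_affine)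
    then have "height i z = height i a" using eq by (simp add: algebra_simps)
    then show False using tri_subset_plane[OF iT z(2)] a[OF iT] plane(2)[OF iT] by simp
  qed
qed auto

text \<open>The triangle \<open>a b c\<close> has the midpoint of the edge as centroid and replaces a small circle
  around the edge. Since \<open>c\<close> is determined by \<open>a\<close> and \<open>b\<close>, its general position is imposed on \<open>b\<close>.\<close>
lemma edge_link_triangle:
  assumes i0: "i0 \<in> T" and vw: "{v, w} \<subseteq> \<tau> i0" "v \<noteq> w"
  obtains a b c where "card {a, b, c} = 3" "\<not> affine_dependent {a, b, c}" "midpoint v w = (1/3) *\<^sub>R (a + b + c)"
    "\<And>u. u \<in> verts \<Longrightarrow> u \<notin> affine hull {a, b, c}"
    "\<And>s i. s \<in> {a, b, c} \<Longrightarrow> i \<in> T \<Longrightarrow> s \<notin> affine hull (\<tau> i)"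
    "\<And>i u. i \<in> T \<Longrightarrow> u \<in> \<tau> i \<Longrightarrow> \<tau> i - {u} \<noteq> {v, w} \<Longrightarrow> convex hull (\<tau> i - {u}) \<inter> convex hull {a, b, c} = {}"
proof -
  define m where "m = midpoint v w"
  \<comment> \<open>The point \<open>m\<close> also lies in triangle \<open>i0\<close>, so it lies
    in the hull of the common vertices; these must include \<open>v\<close> and
    \<open>w\<close>.\<close>
  have mem: "{v, w} \<subseteq> G" if i: "i \<in> T" and G: "G \<subseteq> \<tau> i" "m \<in> convex hull G" for i G
  proof -
    have "m \<in> convex hull {v, w}" by (simp add: m_def flip: segment_convex_hull)
    then have "m \<in> convex hull (\<tau> i0)" using hull_mono[OF vw(1)] by blast
    then have "m \<in> convex hull (\<tau> i \<inter> \<tau> i0)" using hull_Int[OF i i0] hull_mono[OF G(1)] G(2) by blast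
    then have "{v, w} \<subseteq> \<tau> i \<inter> \<tau> i0"
      using midpoint_in_hull_subset[OF indep_\<tau>[OF i0] vw, of "\<tau> i \<inter> \<tau> i0"] by (simp add: m_def)
    then have "{v, w} \<subseteq> \<tau> i" by blast
    then show ?thesis
      using midpoint_in_hull_subset[OF indep_\<tau>[OF i] _ vw(2) G(1)] G(2) by (simp add: m_def)
  qed
  have m_verts: "m \<notin> verts"
  proof
    assume "m \<in> verts"
    then obtain i where "i \<in> T" "m \<in> \<tau> i" by (auto simp: verts_def)
    then have "{v, w} \<subseteq> {m}" using mem[of i "{m}"] by simp
    then show False using vw(2) by auto
  qed
  have m_edge: "m \<notin> convex hull (\<tau> i - {u})" if "i \<in> T" "u \<in> \<tau> i" "\<tau> i - {u} \<noteq> {v, w}" for i u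
  proof
    assume "m \<in> convex hull (\<tau> i - {u})"
    then have "{v, w} \<subseteq> \<tau> i - {u}" using mem[of i "\<tau> i - {u}"] that(1) by blast
    moreover have "card (\<tau> i - {u}) = 2" using that card_\<tau> by simp
    ultimately have "\<tau> i - {u} = {v, w}"
      using vw(2) card_subset_eq[of "\<tau> i - {u}" "{v, w}"] finite_\<tau>[OF that(1)] by simp
    then show False using that(3) by simp
  qed
  define Z where "Z = (\<Union>E\<in>{\<tau> i - {u} | i u. i \<in> T \<and> u \<in> \<tau> i \<and> \<tau> i - {u} \<noteq> {v, w}}. convex hull E)"
  have "finite {\<tau> i - {u} | i u. i \<in> T \<and> u \<in> \<tau> i \<and> \<tau> i - {u} \<noteq> {v, w}}"
    by (rule finite_subset[OF _ finite_Pow_iff[THEN iffD2, OF finite_verts]]) (auto simp: verts_def)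
  moreover have "closed (convex hull (\<tau> i - {u}))" if "i \<in> T" for i u
    using finite_\<tau>[OF that] by (intro compact_imp_closed finite_imp_compact_convex_hull) simp
  ultimately have "closed Z" unfolding Z_def by (intro closed_UN) auto
  moreover have "m \<notin> Z" using m_edge by (auto simp: Z_def)
  ultimately obtain r where r: "r > 0" "ball m r \<subseteq> - Z"
    using open_contains_ball[of "- Z"] by (auto simp: open_Compl)
  \<comment> \<open>As \<open>c b - m\<close> is minus the sum of \<open>a - m\<close> and
    \<open>b - m\<close>, half the radius for \<open>a\<close> and \<open>b\<close> keeps the third
    corner within \<open>r\<close>.\<close>
  define B where "B = ball m (r / 2)"
  have B: "open B" "B \<noteq> {}" using r(1) by (auto simp: B_def)
  obtain a where a: "a \<in> B" "generic (insert m verts) a"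
    using generic_exists[of "insert m verts" B "{}"] finite_verts B by auto
  define c where "c b = 3 *\<^sub>R m - a - b" for b
  \<comment> \<open>The choices of \<open>b\<close> that put the third corner into the plane of some
    triangle. The third corner is an affine function of \<open>b\<close>, so they form finitely many
    planes.\<close>
  define N where "N = (\<Union>i\<in>T. {b. height i (c b) = 0})"
  have "negligible N" unfolding N_def
  proof (intro negligible_Union finite_imageI finite_T)
    fix X assume "X \<in> (\<lambda>i. {b. height i (c b) = 0}) ` T"
    then obtain i where i: "i \<in> T" "X = {b. height i (c b) = 0}" by blast
    have "X = {b. fst (plane i) \<bullet> b = fst (plane i) \<bullet> (3 *\<^sub>R m - a) - snd (plane i)}"
      unfolding i(2) c_def height_def by (auto simp: inner_diff_right)
    then show "negligible X" using plane(1)[OF i(1)] by (simp add: negligible_hyperplane)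
  qed
  then obtain b where b: "b \<in> B" "generic (insert a (insert m verts)) b" "b \<notin> N"
    using generic_exists[of "insert a (insert m verts)" B N] finite_verts B by auto
  let ?S = "{a, b, c b}"
  have centroid: "m = (1/3) *\<^sub>R (a + b + c b)" by (simp add: c_def)
  have indep4: "\<not> affine_dependent {b, a, m, u}" if u: "u \<in> verts" for u
  proof -
    have "m \<noteq> u" using m_verts u by blast
    then have "\<not> affine_dependent {a, m, u}"
      using u by (intro affine_independent_insert_generic[OF _ a(2)]) (auto simp: affine_independent_2)
    moreover have "card {a, m, u} \<le> 3"
      using card_insert_le_m1[of 3 "{m, u}" a] card_insert_le_m1[of 2 "{u}" m] by simp
    ultimately show ?thesis
      using u by (intro affine_independent_insert_generic[OF _ b(2)]) auto
  qed
  have v: "v \<in> verts" using vw i0 by (auto simp: verts_def)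
  have ne: "b \<noteq> a" "b \<noteq> m" "a \<noteq> m" using generic_notin[OF b(2)] generic_notin[OF a(2)] by auto
  have indep_abm: "\<not> affine_dependent {a, b, m}"
    by (rule contrapos_nn[OF indep4[OF v]], erule affine_dependent_subset) auto
  \<comment> \<open>The corner \<open>c b\<close> is not itself generic. Replacing it by
    \<open>m\<close> leaves the plane unchanged and expresses that plane by points for which
    genericity is known.\<close>
  have hull_eq: "affine hull ?S = affine hull {a, b, m}"
  proof
    have "c b = (-1) *\<^sub>R a + (-1) *\<^sub>R b + 3 *\<^sub>R m" by (simp add: c_def)
    moreover have "(-1) *\<^sub>R a + (-1) *\<^sub>R b + 3 *\<^sub>R m \<in> affine hull {a, b, m}"
      by (rule affine_combination_3) simp
    ultimately have "c b \<in> affine hull {a, b, m}" by (simp only:)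
    then show "affine hull ?S \<subseteq> affine hull {a, b, m}"
      by (intro hull_minimal affine_affine_hull) (auto simp: hull_inc)
    have "m = (1/3) *\<^sub>R a + (1/3) *\<^sub>R b + (1/3) *\<^sub>R c b" using centroid by (simp add: scaleR_add_right)
    moreover have "(1/3) *\<^sub>R a + (1/3) *\<^sub>R b + (1/3) *\<^sub>R c b \<in> affine hull ?S"
      by (rule affine_combination_3) simp
    ultimately have "m \<in> affine hull ?S" by (simp only:)
    then show "affine hull {a, b, m} \<subseteq> affine hull ?S"
      by (intro hull_minimal affine_affine_hull) (auto simp: hull_inc)
  qed
  have dim: "aff_dim ?S = 2"
  proof -
    have "aff_dim ?S = aff_dim {a, b, m}" using hull_eq by (metis aff_dim_affine_hull)
    moreover have "card {a, b, m} = 3" using ne by simp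
    ultimately show ?thesis using aff_dim_affine_independent[OF indep_abm] by simp
  qed
  have card: "card ?S = 3"
  proof -
    have "card ?S \<le> 3" using card_insert_le_m1[of 3 "{b, c b}" a] card_insert_le_m1[of 2 "{c b}" b] by simp
    moreover have "aff_dim ?S \<le> int (card ?S) - 1" by (intro aff_dim_le_card) simp
    ultimately show ?thesis using dim by linarith
  qed
  have indep: "\<not> affine_dependent ?S" using card dim by (simp add: affine_independent_iff_card)
  have ball_S: "convex hull ?S \<subseteq> ball m r"
  proof (intro hull_minimal convex_ball)
    have "norm (c b - m) \<le> norm (a - m) + norm (b - m)"
    proof -
      have "c b - m = - ((a - m) + (b - m))" by (simp add: c_def vec_eq_iff)
      then show ?thesis by (metis norm_minus_cancel norm_triangle_ineq)
    qed
    moreover have "norm (a - m) < r / 2" "norm (b - m) < r / 2"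
      using a(1) b(1) by (simp_all add: B_def dist_norm norm_minus_commute)
    moreover note r(1)
    ultimately have "norm (a - m) < r" "norm (b - m) < r" "norm (c b - m) < r" by linarith+
    then show "?S \<subseteq> ball m r" by (simp add: dist_norm norm_minus_commute[of m])
  qed
  show ?thesis
  proof (rule that[of a b "c b"])
    show "midpoint v w = (1/3) *\<^sub>R (a + b + c b)" using centroid by (simp add: m_def)
    show "u \<notin> affine hull ?S" if u: "u \<in> verts" for u
    proof -
      have "u \<noteq> m" "u \<noteq> a" "u \<noteq> b" using u m_verts generic_notin[OF a(2)] generic_notin[OF b(2)] by auto
      then have "affine hull {a, b, m} \<inter> affine hull {u} = {}"
        by (intro disjoint_affine_hull[OF indep4[OF u]]) auto
      then show ?thesis unfolding hull_eq by (auto simp: hull_inc)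
    qed
    show "s \<notin> affine hull (\<tau> i)" if s: "s \<in> ?S" and i: "i \<in> T" for s i
    proof -
      have "\<tau> i \<subseteq> verts" using i by (auto simp: verts_def)
      then have "a \<notin> affine hull (\<tau> i)" "b \<notin> affine hull (\<tau> i)"
        using genericD[OF a(2), of "\<tau> i"] genericD[OF b(2), of "\<tau> i"] card_\<tau>[OF i] finite_\<tau>[OF i] by auto
      moreover have "c b \<notin> affine hull (\<tau> i)" using b(3) i plane(2)[OF i] by (auto simp: N_def)
      ultimately show ?thesis using s by auto
    qed
    show "convex hull (\<tau> i - {u}) \<inter> convex hull ?S = {}"
      if "i \<in> T" "u \<in> \<tau> i" "\<tau> i - {u} \<noteq> {v, w}" for i u
    proof -
      have "convex hull (\<tau> i - {u}) \<subseteq> Z" unfolding Z_def using that by blast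
      then show ?thesis using ball_S r(2) by blast
    qed
  qed (use card indep in auto)
qed

text \<open>The changes of \<open>f\<close> around the small triangle cancel. By parity, its sides
  crossing a triangle of the system may be replaced by the sides of that triangle crossing it, and
  \<open>E\<close> is the only edge that does so. What remains is the boundary coefficient at
  \<open>E\<close>.\<close>

lemma boundary_jump:
  assumes f: "colouring f" and E: "card E = 2"
  shows "boundary (jump f) E = 0"
proof (cases "\<exists>i\<in>T. E \<subseteq> \<tau> i")
  case False
  then have "{i \<in> T. E \<subseteq> \<tau> i} = {}" by blast
  then show ?thesis by (simp only: boundary_def sum.empty)
next
  case True
  then obtain i0 where i0: "i0 \<in> T" "E \<subseteq> \<tau> i0" by blast
  obtain v w where vw: "E = {v, w}" "v \<noteq> w" using E by (auto simp: card_2_iff)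
  obtain a b c where S: "card {a, b, c} = 3" "\<not> affine_dependent {a, b, c}"
    and m: "midpoint v w = (1/3) *\<^sub>R (a + b + c)"
    and V: "\<And>u. u \<in> verts \<Longrightarrow> u \<notin> affine hull {a, b, c}"
    and off: "\<And>s i. s \<in> {a, b, c} \<Longrightarrow> i \<in> T \<Longrightarrow> s \<notin> affine hull (\<tau> i)"
    and far: "\<And>i u. i \<in> T \<Longrightarrow> u \<in> \<tau> i \<Longrightarrow> \<tau> i - {u} \<noteq> {v, w} \<Longrightarrow> convex hull (\<tau> i - {u}) \<inter> convex hull {a, b, c} = {}"
    using edge_link_triangle[OF i0(1)] i0(2) vw by (metis (no_types, lifting))
  let ?S = "{a, b, c}"
  have ne: "a \<noteq> b" "a \<noteq> c" "b \<noteq> c" using S(1) by (auto simp: card_insert_if split: if_splits)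
  have diffs: "?S - {a} = {b, c}" "?S - {b} = {a, c}" "?S - {c} = {a, b}" using ne by auto
  have \<tau>V: "u \<in> verts" if "i \<in> T" "u \<in> \<tau> i" for i u using that by (auto simp: verts_def)
  have mS: "midpoint v w \<in> convex hull ?S"
    unfolding m convex_hull_3 by (auto simp: scaleR_add_right intro!: exI[of _ "1/3"])
  have disj: "convex hull (?S - {s}) \<inter> convex hull (\<tau> i - {u}) = {}"
    if s: "s \<in> ?S" and i: "i \<in> T" and u: "u \<in> \<tau> i" for s i u
  proof (cases "\<tau> i - {u} = {v, w}")
    case False
    have "convex hull (?S - {s}) \<subseteq> convex hull ?S" by (intro hull_mono) auto
    then show ?thesis using far[OF i u False] by blast
  next
    case True
    \<comment> \<open>The edge meets the plane of the small triangle only in its midpoint, which is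
      the centroid and thus on none of the three sides.\<close>
    obtain h k where h: "affine hull ?S = {x. h \<bullet> x = k}" using plane_through_triangle[OF S] by blast
    have "v \<in> verts" using i0 vw \<tau>V by auto
    then have hv: "h \<bullet> v \<noteq> k" using V[of v] h by blast
    have hm: "h \<bullet> midpoint v w = k" using mS convex_hull_subset_affine_hull[of ?S] h by blast
    show ?thesis
    proof (rule ccontr)
      assume "convex hull (?S - {s}) \<inter> convex hull (\<tau> i - {u}) \<noteq> {}"
      then obtain z where z: "z \<in> convex hull (?S - {s})" "z \<in> convex hull {v, w}" unfolding True by blast
      have "z \<in> convex hull ?S" using z(1) hull_mono[of "?S - {s}" ?S] by blast
      then have "h \<bullet> z = k" using convex_hull_subset_affine_hull[of ?S] h by blast
      then have "z = midpoint v w" using midpoint_unique_on_plane[OF z(2) _ hm hv] by blast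
      then show False using centroid_notin_edge[OF S(2) ne s] z(1) m by simp
    qed
  qed
  have seg: "f p + f q = (\<Sum>i\<in>T. jump f i * of_bool (convex hull {p, q} \<inter> convex hull (\<tau> i) \<noteq> {}))"
    if pq: "p \<in> ?S" "q \<in> ?S" "s \<in> ?S" "{p, q} = ?S - {s}" for p q s
  proof -
    have "f p + f q = sum (jump f) (hits p q)"
    proof (rule colouring_along_generic_segment[OF f])
      show "closed_segment p q \<inter> convex hull (\<tau> i - {u}) = {}" if "i \<in> T" "u \<in> \<tau> i" for i u
        unfolding segment_convex_hull pq(4) using disj[OF pq(3) that] by blast
    qed (use off pq in auto)
    then show ?thesis unfolding sum_hits segment_convex_hull .
  qed
  have "0 = (f a + f b) + (f a + f c) + (f b + f c)"
    by (cases "f a"; cases "f b"; cases "f c") auto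
  also have "\<dots> = (\<Sum>i\<in>T. jump f i * of_bool (convex hull {a, b} \<inter> convex hull (\<tau> i) \<noteq> {}))
     + (\<Sum>i\<in>T. jump f i * of_bool (convex hull {a, c} \<inter> convex hull (\<tau> i) \<noteq> {}))
     + (\<Sum>i\<in>T. jump f i * of_bool (convex hull {b, c} \<inter> convex hull (\<tau> i) \<noteq> {}))"
    using seg[of a b c] seg[of a c b] seg[of b c a] diffs by simp
  also have "\<dots> = (\<Sum>i\<in>T. jump f i * (\<Sum>s\<in>?S. of_bool (convex hull (?S - {s}) \<inter> convex hull (\<tau> i) \<noteq> {})))"
    unfolding sum_triple[of ?S a b c, OF refl ne] diffs
    by (simp only: distrib_left sum.distrib ac_simps)
  also have "\<dots> = (\<Sum>i\<in>T. jump f i * (\<Sum>u\<in>\<tau> i. of_bool (convex hull (\<tau> i - {u}) \<inter> convex hull ?S \<noteq> {})))"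
  proof (rule sum.cong[OF refl])
    fix i assume i: "i \<in> T"
    have "(\<Sum>s\<in>?S. of_bool (convex hull (?S - {s}) \<inter> convex hull (\<tau> i) \<noteq> {}))
      = (\<Sum>u\<in>\<tau> i. of_bool (convex hull (\<tau> i - {u}) \<inter> convex hull ?S \<noteq> {}) :: bit)"
      by (rule bit_add_eq_0, rule independent_triangles_crossing_parity
          [OF S off[OF _ i] card_\<tau>[OF i] indep_\<tau>[OF i] V[OF \<tau>V[OF i]] disj[OF _ i]])
    then show "jump f i * (\<Sum>s\<in>?S. of_bool (convex hull (?S - {s}) \<inter> convex hull (\<tau> i) \<noteq> {}))
      = jump f i * (\<Sum>u\<in>\<tau> i. of_bool (convex hull (\<tau> i - {u}) \<inter> convex hull ?S \<noteq> {}))" by simp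
  qed
  also have "\<dots> = (\<Sum>F | F \<subseteq> verts \<and> card F = 2. of_bool (convex hull F \<inter> convex hull ?S \<noteq> {}) * boundary (jump f) F)"
    by (rule sum_edges_swap)
  \<comment> \<open>A pair \<open>F\<close> other than \<open>E\<close> is either an edge that stays
    away from the small triangle or no edge at all; in the latter case its hull may meet the
    triangle, but its boundary coefficient is 0.\<close>
  also have "\<dots> = (\<Sum>F | F \<subseteq> verts \<and> card F = 2. if F = E then boundary (jump f) E else 0)"
  proof (rule sum.cong[OF refl])
    fix F assume F: "F \<in> {F. F \<subseteq> verts \<and> card F = 2}"
    show "of_bool (convex hull F \<inter> convex hull ?S \<noteq> {}) * boundary (jump f) F
      = (if F = E then boundary (jump f) E else 0)"
    proof (cases "F = E")
      case True
      have "midpoint v w \<in> convex hull F"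
        unfolding True vw by (simp flip: segment_convex_hull)
      then have "convex hull F \<inter> convex hull ?S \<noteq> {}" using mS by blast
      then show ?thesis using True by simp
    next
      case False
      show ?thesis
      proof (cases "\<exists>i\<in>T. F \<subseteq> \<tau> i")
        case True
        then obtain i where i: "i \<in> T" "F \<subseteq> \<tau> i" by blast
        then obtain u where u: "u \<in> \<tau> i" "F = \<tau> i - {u}"
          using two_subset_of_three[OF i(2)] F card_\<tau>[OF i(1)] by blast
        then have "convex hull F \<inter> convex hull ?S = {}" using far[OF i(1) u(1)] False vw(1) by simp
        then show ?thesis using False by simp
      next
        case no: False
        then have "{i \<in> T. F \<subseteq> \<tau> i} = {}" by blast
        then have "boundary (jump f) F = 0" by (simp only: boundary_def sum.empty)
        then show ?thesis using False by simp
      qed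
    qed
  qed
  also have "\<dots> = boundary (jump f) E"
  proof -
    have "E \<in> {F. F \<subseteq> verts \<and> card F = 2}" using E i0 by (auto simp: verts_def)
    then show ?thesis using finite_verts by simp
  qed
  finally show ?thesis by simp
qed

end

lemma sum_fun_apply: "(\<Sum>c\<in>A. F c) i = (\<Sum>c\<in>A. F c i)"
  by (induction A rule: infinite_finite_induct) auto

section \<open>Cycles are jumps of colourings\<close>

context triangle_system
begin

text \<open>Path independence of the crossing count modulo 2. Parity and the exchange of summation
  leave only boundary coefficients of \<open>x\<close>, which are zero.\<close>

lemma sum_hits_generic_triangle:
  fixes x :: "'i \<Rightarrow> bit"
  assumes x: "\<And>E. card E = 2 \<Longrightarrow> boundary x E = 0"
    and o: "generic verts o'" and p: "generic (insert o' verts) p" and q: "generic (insert o' (insert p verts)) q"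
  shows "sum x (hits o' p) + sum x (hits p q) = sum x (hits o' q)"
proof -
  have \<tau>V: "\<tau> i \<subseteq> verts" if "i \<in> T" for i using that by (auto simp: verts_def)
  have "(sum x (hits o' p) + sum x (hits p q)) + sum x (hits o' q)
      = (\<Sum>i\<in>T. x i * (of_bool (closed_segment o' p \<inter> convex hull (\<tau> i) \<noteq> {})
          + of_bool (closed_segment p q \<inter> convex hull (\<tau> i) \<noteq> {})
          + of_bool (closed_segment o' q \<inter> convex hull (\<tau> i) \<noteq> {})))"
    unfolding sum_hits by (simp only: distrib_left sum.distrib)
  also have "\<dots> = (\<Sum>i\<in>T. x i * (\<Sum>v\<in>\<tau> i. of_bool (convex hull (\<tau> i - {v}) \<inter> convex hull {o', p, q} \<noteq> {})))"
  proof (rule sum.cong[OF refl])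
    fix i assume i: "i \<in> T"
    have "generic (\<tau> i) o'" "generic (insert o' (\<tau> i)) p" "generic (insert o' (insert p (\<tau> i))) q"
      using \<tau>V[OF i] by (auto intro: generic_mono[OF o] generic_mono[OF p] generic_mono[OF q])
    from generic_triangle_crossing_parity[OF card_\<tau>[OF i] indep_\<tau>[OF i] this]
    show "x i * (of_bool (closed_segment o' p \<inter> convex hull (\<tau> i) \<noteq> {})
          + of_bool (closed_segment p q \<inter> convex hull (\<tau> i) \<noteq> {})
          + of_bool (closed_segment o' q \<inter> convex hull (\<tau> i) \<noteq> {}))
        = x i * (\<Sum>v\<in>\<tau> i. of_bool (convex hull (\<tau> i - {v}) \<inter> convex hull {o', p, q} \<noteq> {}))"
      by (simp only:)
  qed
  also have "\<dots> = (\<Sum>E | E \<subseteq> verts \<and> card E = 2. of_bool (convex hull E \<inter> convex hull {o', p, q} \<noteq> {}) * boundary x E)"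
    by (rule sum_edges_swap)
  also have "\<dots> = 0" using x by (intro sum.neutral) auto
  finally show ?thesis by (rule bit_add_eq_0)
qed

lemma colouring_with_jump:
  fixes x :: "'i \<Rightarrow> bit"
  assumes x: "\<And>E. card E = 2 \<Longrightarrow> boundary x E = 0"
  obtains f where "colouring f" "\<And>i. i \<in> T \<Longrightarrow> jump f i = x i"
proof -
  obtain o' where o: "generic verts o'"
    using generic_exists[OF finite_verts, of UNIV "{}"] by auto
  define good where "good p \<longleftrightarrow> generic (insert o' verts) p" for p
  define c where "c p = sum x (hits o' p)" for p
  have good_exists: "\<exists>p\<in>S. good p" if "open S" "S \<noteq> {}" for S
    using generic_exists[of "insert o' verts" S "{}"] that finite_verts unfolding good_def by auto
  have c_step: "c p + sum x (hits p q) = c q" if "good p" "generic (insert o' (insert p verts)) q" for p q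
    unfolding c_def using sum_hits_generic_triangle[OF x o] that by (simp add: good_def)
  \<comment> \<open>Two good points need not be in general position to each other, so both are
    compared with a third point generic relative to both. All segments used stay in the ball and hit
    nothing.\<close>
  have c_ball: "c p = c p'" if B: "ball z r \<subseteq> - body" and p: "p \<in> ball z r" "good p" and p': "p' \<in> ball z r" "good p'"
    for z r p p'
  proof -
    have "ball z r \<noteq> {}" using p by blast
    then obtain q where q: "q \<in> ball z r" "generic (insert o' (insert p (insert p' verts))) q"
      using generic_exists[of "insert o' (insert p (insert p' verts))" "ball z r" "{}"] finite_verts by auto
    have "hits s q = {}" if "s \<in> ball z r" for s
    proof -
      have "closed_segment s q \<subseteq> ball z r" using that q(1) by (simp add: closed_segment_subset)
      then have "closed_segment s q \<inter> body = {}" using B by blast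
      then show ?thesis by (auto simp: hits_def body_def)
    qed
    then have "hits p q = {}" "hits p' q = {}" using p p' by auto
    moreover have "generic (insert o' (insert p verts)) q" "generic (insert o' (insert p' verts)) q"
      by (auto intro: generic_mono[OF q(2)])
    ultimately show ?thesis using c_step[OF p(2), of q] c_step[OF p'(2), of q]
      by (simp only: sum.empty add_0_right)
  qed
  \<comment> \<open>The local constancy just shown concerns good points only. As these are dense, it
    still propagates through a connected open set.\<close>
  have c_component: "c p = c p'" if cc: "connected_component (- body) p p'" and good: "good p" "good p'" for p p'
  proof -
    let ?C = "connected_component_set (- body) p"
    have mem: "p \<in> ?C" "p' \<in> ?C" using cc connected_component_in[OF cc] by auto
    have openC: "open ?C" by (rule open_connected_component[OF open_complement])
    have "c p' = c p"
    proof (rule connected_induction[where S = ?C and P = good and Q = "\<lambda>y. c y = c p" and a = p and b = p'])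
      show "\<exists>z. z \<in> S \<and> good z" if "openin (top_of_set ?C) S" "a \<in> S" for S a
        using good_exists[of S] that openC by (auto simp: openin_open_eq)
      show "\<exists>S. openin (top_of_set ?C) S \<and> a \<in> S \<and> (\<forall>y\<in>S. \<forall>z\<in>S. good y \<and> good z \<and> c y = c p \<longrightarrow> c z = c p)"
        if a: "a \<in> ?C" for a
      proof -
        obtain r where r: "r > 0" "ball a r \<subseteq> ?C" using openC a open_contains_ball by blast
        have "ball a r \<subseteq> - body" using r(2) connected_component_subset[of "- body" p] by blast
        then have "\<forall>y\<in>ball a r. \<forall>z\<in>ball a r. good y \<and> good z \<and> c y = c p \<longrightarrow> c z = c p"
          using c_ball by metis
        moreover have "openin (top_of_set ?C) (ball a r)" using r(2) openC by (simp add: openin_open_eq)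
        moreover have "a \<in> ball a r" using r(1) by simp
        ultimately show ?thesis by (intro exI[of _ "ball a r"] conjI)
      qed
    qed (use mem good in auto)
    then show ?thesis by simp
  qed
  \<comment> \<open>outside the complement of the body the choice is from an empty predicate, but harmless\<close>
  define f where "f z = c (SOME p. good p \<and> connected_component (- body) z p)" for z
  have "colouring f"
    unfolding colouring_def
  proof (intro allI impI)
    fix p q assume "connected_component (- body) p q"
    then have "connected_component (- body) p z \<longleftrightarrow> connected_component (- body) q z" for z
      by (metis connected_component_sym connected_component_trans)
    then show "f p = f q" by (simp add: f_def)
  qed
  have f_good: "f p = c p" if p: "good p" "p \<notin> body" for p
  proof -
    have "good p \<and> connected_component (- body) p p" using p by (simp add: connected_component_refl)
    then have "good (SOME q. good q \<and> connected_component (- body) p q)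
       \<and> connected_component (- body) p (SOME q. good q \<and> connected_component (- body) p q)"
      by (rule someI)
    then show ?thesis unfolding f_def using c_component p(1) by metis
  qed
  have "jump f i = x i" if i: "i \<in> T" for i
  proof -
    obtain q r where qr: "nice i q r" using nice_nonempty[OF i] .
    obtain p where p: "p \<in> ball q r" "height i p > 0" "good p"
      using good_exists[OF open_half_ball half_ball_nonempty[OF i qr, of 1]] by auto
    \<comment> \<open>\<open>c_step\<close> requires genericity relative to \<open>p\<close> as
      well, which is more than \<open>good p'\<close>.\<close>
    obtain p' where p': "p' \<in> ball q r" "height i p' < 0" "generic (insert o' (insert p verts)) p'"
      using generic_exists[OF _ open_half_ball half_ball_nonempty[OF i qr, of "-1"], of "insert o' (insert p verts)" "{}"]
        finite_verts by auto
    have p'_good: "good p'" unfolding good_def by (rule generic_mono[OF p'(3)]) auto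
    have off: "p \<notin> body" "p' \<notin> body" using nice_ball_body[OF i qr] p p' by auto
    have seg: "closed_segment p p' \<subseteq> ball q r" using p(1) p'(1) by (simp add: closed_segment_subset)
    \<comment> \<open>The parameter at which the affine height, of opposite signs at
      \<open>p\<close> and \<open>p'\<close>, vanishes; there the segment crosses triangle
      \<open>i\<close>.\<close>
    define u where "u = height i p / (height i p - height i p')"
    have u: "0 \<le> u" "u \<le> 1" using p(2) p'(2) by (auto simp: u_def field_simps)
    define z where "z = (1 - u) *\<^sub>R p + u *\<^sub>R p'"
    have z: "z \<in> closed_segment p p'" unfolding in_segment z_def using u by blast
    have "height i z = height i p - u * (height i p - height i p')"
      unfolding z_def height_affine by (simp add: algebra_simps)
    also have "\<dots> = 0" using p(2) p'(2) by (simp add: u_def)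
    finally have "z \<in> affine hull (\<tau> i)" using plane(2)[OF i] by simp
    then have "z \<in> tri i" using z seg qr unfolding nice_def by blast
    then have "i \<in> hits p p'" using i z by (auto simp: hits_def)
    moreover have "j = i" if j: "j \<in> hits p p'" for j
    proof (rule ccontr)
      assume "j \<noteq> i"
      then have "ball q r \<inter> tri j = {}" using j qr by (simp add: nice_def hits_def)
      then show False using seg j by (auto simp: hits_def)
    qed
    ultimately have "hits p p' = {i}" by blast
    then have "c p + x i = c p'" using c_step[OF p(3) p'(3)] by simp
    moreover have "height i p * height i p' < 0" using p(2) p'(2) by (simp add: mult_less_0_iff)
    then have "c p + c p' = jump f i"
      using colouring_across[OF \<open>colouring f\<close> i qr p(1) p'(1)] f_good p(3) p'_good off by simp
    ultimately show ?thesis by (cases "c p"; cases "c p'"; cases "x i"; cases "jump f i") auto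
  qed
  then show ?thesis using that \<open>colouring f\<close> by blast
qed

section \<open>Boundary vectors of cells and the 2-basis\<close>

definition cell_boundary :: "(real^3) set \<Rightarrow> 'i \<Rightarrow> bit" where
  "cell_boundary C i = (if i \<in> T then jump (\<lambda>p. of_bool (p \<in> C)) i else 0)"

text \<open>Indexing by the sides of triangles makes finiteness immediate. A component containing no
  side point would have boundary zero.\<close>

definition cells :: "(real^3) set set" where
  "cells = (\<lambda>(i, s). connected_component_set (- body) (side i s)) ` (T \<times> {1, - 1})"

definition cycles :: "('i \<Rightarrow> bit) set" where
  "cycles = {x. (\<forall>i. i \<notin> T \<longrightarrow> x i = 0) \<and> (\<forall>E. card E = 2 \<longrightarrow> boundary x E = 0)}"

lemma finite_cells: "finite cells"
  using finite_T by (simp add: cells_def)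

lemma colouring_cell: "C \<in> cells \<Longrightarrow> colouring (\<lambda>p. of_bool (p \<in> C))"
  unfolding cells_def colouring_def
  by (auto simp: of_bool_def dest: connected_component_trans connected_component_sym)

lemma cell_boundary_in_cycles:
  assumes "C \<in> cells"
  shows "cell_boundary C \<in> cycles"
proof -
  have "boundary (cell_boundary C) E = boundary (jump (\<lambda>p. of_bool (p \<in> C))) E" for E
    unfolding boundary_def by (intro sum.cong) (auto simp: cell_boundary_def)
  then show ?thesis
    using boundary_jump[OF colouring_cell[OF assms]] by (auto simp: cycles_def cell_boundary_def)
qed

lemma side_notin_body:
  assumes "i \<in> T" "s \<noteq> 0"
  shows "side i s \<notin> body"
proof -
  obtain q r where qr: "nice i q r" using nice_nonempty[OF assms(1)] .
  obtain p where "p \<in> ball q r" "s * height i p > 0"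
    using half_ball_nonempty[OF assms(1) qr assms(2)] by blast
  then have "connected_component (- body) p (side i s)" by (rule connected_to_side[OF assms(1) qr assms(2)])
  then show ?thesis using connected_component_in by fastforce
qed

lemma cells_containing:
  assumes "C \<in> cells" "p \<in> C"
  shows "C = connected_component_set (- body) p"
proof -
  obtain y where C: "C = connected_component_set (- body) y" using assms(1) by (auto simp: cells_def)
  show ?thesis using assms(2) unfolding C by (rule connected_component_eq[symmetric])
qed

lemma cell_of_side:
  assumes "i \<in> T" "s \<in> {1, - 1}"
  shows "{C \<in> cells. side i s \<in> C} = {connected_component_set (- body) (side i s)}"
proof -
  have "s \<noteq> 0" using assms(2) by auto
  then have "side i s \<in> connected_component_set (- body) (side i s)"
    using side_notin_body[OF assms(1)] by (simp add: connected_component_refl)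
  moreover have "connected_component_set (- body) (side i s) \<in> cells"
    unfolding cells_def using assms by force
  ultimately show ?thesis using cells_containing by blast
qed

text \<open>A cell with nonzero coefficient at \<open>i\<close> contains one of the two side points,
  and each of these determines its cell. Vectors are counted, not cells; distinct cells with equal
  boundary only lower the number.\<close>

lemma card_cell_boundaries_le_2:
  assumes "i \<in> T"
  shows "finite {b \<in> cell_boundary ` cells. b i \<noteq> 0}" "card {b \<in> cell_boundary ` cells. b i \<noteq> 0} \<le> 2"
proof -
  let ?K = "\<lambda>s. connected_component_set (- body) (side i s)"
  have sub: "{b \<in> cell_boundary ` cells. b i \<noteq> 0} \<subseteq> {cell_boundary (?K 1), cell_boundary (?K (- 1))}"
  proof
    fix b assume "b \<in> {b \<in> cell_boundary ` cells. b i \<noteq> 0}"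
    then obtain C where C: "C \<in> cells" "b = cell_boundary C" "cell_boundary C i \<noteq> 0" by blast
    then have "side i 1 \<in> C \<or> side i (- 1) \<in> C"
      by (auto simp: cell_boundary_def jump_def split: if_splits)
    then have "C = ?K 1 \<or> C = ?K (- 1)" using cells_containing[OF C(1)] by blast
    then show "b \<in> {cell_boundary (?K 1), cell_boundary (?K (- 1))}" using C(2) by blast
  qed
  then show "finite {b \<in> cell_boundary ` cells. b i \<noteq> 0}" by (rule finite_subset) simp
  have "card {b \<in> cell_boundary ` cells. b i \<noteq> 0} \<le> card {cell_boundary (?K 1), cell_boundary (?K (- 1))}"
    using sub by (rule card_mono[rotated]) simp
  also have "\<dots> \<le> 2" by (simp add: card_insert_if)
  finally show "card {b \<in> cell_boundary ` cells. b i \<noteq> 0} \<le> 2" .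
qed

text \<open>At the side points a colouring agrees with the combination of the indicators of cells
  whose coefficients are its values. Jumps depend linearly on the colouring, so the cycle is the
  same combination of cell boundaries.\<close>

lemma cycles_subset_span: "cycles \<subseteq> gf2.span (cell_boundary ` cells)"
proof
  fix x assume x: "x \<in> cycles"
  then obtain f where f: "colouring f" "\<And>i. i \<in> T \<Longrightarrow> jump f i = x i"
    using colouring_with_jump[of x] by (auto simp: cycles_def)
  define g where "g C = f (SOME p. p \<in> C)" for C
  have g: "g C = f p" if "C \<in> cells" "p \<in> C" for C p
  proof -
    have "(SOME p. p \<in> C) \<in> C" using that(2) by (rule someI)
    then have "connected_component (- body) p (SOME p. p \<in> C)" using cells_containing[OF that] by simp
    then show ?thesis using f(1) unfolding g_def colouring_def by metis
  qed
  have side_sum: "(\<Sum>C\<in>cells. g C * of_bool (side i s \<in> C)) = f (side i s)" if i: "i \<in> T" "s \<in> {1, - 1}" for i s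
  proof -
    have "(\<Sum>C\<in>cells. g C * of_bool (side i s \<in> C)) = (\<Sum>C\<in>cells. if side i s \<in> C then g C else 0)"
      by (intro sum.cong) auto
    also have "\<dots> = sum g {C \<in> cells. side i s \<in> C}"
      using finite_cells by (simp only: sum.inter_filter)
    also have "\<dots> = sum g {connected_component_set (- body) (side i s)}" by (simp only: cell_of_side[OF i])
    also have "\<dots> = g (connected_component_set (- body) (side i s))" by simp
    also have "\<dots> = f (side i s)"
    proof (rule g)
      show "connected_component_set (- body) (side i s) \<in> cells" "side i s \<in> connected_component_set (- body) (side i s)"
        using cell_of_side[OF i] by blast+
    qed
    finally show ?thesis .
  qed
  have "x i = (\<Sum>C\<in>cells. gf2_scale (g C) (cell_boundary C)) i" for i
  proof (cases "i \<in> T")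
    case True
    have "(\<Sum>C\<in>cells. gf2_scale (g C) (cell_boundary C)) i
      = (\<Sum>C\<in>cells. g C * (of_bool (side i 1 \<in> C) + of_bool (side i (- 1) \<in> C)))"
      using True by (simp only: sum_fun_apply gf2_scale_def cell_boundary_def jump_def if_True)
    also have "\<dots> = f (side i 1) + f (side i (- 1))"
      using side_sum[OF True, of 1] side_sum[OF True, of "- 1"] by (simp only: distrib_left sum.distrib insert_iff simp_thms)
    finally show ?thesis using f(2)[OF True] by (simp add: jump_def)
  next
    case False
    then show ?thesis using x by (simp add: cycles_def sum_fun_apply gf2_scale_def cell_boundary_def)
  qed
  then have "x = (\<Sum>C\<in>cells. gf2_scale (g C) (cell_boundary C))" by blast
  moreover have "\<dots> \<in> gf2.span (cell_boundary ` cells)"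
    by (intro gf2.span_sum gf2.span_scale gf2.span_base) simp
  ultimately show "x \<in> gf2.span (cell_boundary ` cells)" by simp
qed

text \<open>The bound of two holds for the whole spanning set and is inherited by the independent
  subset taken from it.\<close>

lemma two_basis_exists:
  assumes "gf2.subspace cycles"
  shows "\<exists>B. two_basis T B cycles"
proof -
  let ?S = "cell_boundary ` cells"
  have S: "?S \<subseteq> cycles" using cell_boundary_in_cycles by blast
  obtain B where B: "B \<subseteq> ?S" "gf2.independent B" "?S \<subseteq> gf2.span B"
    using gf2.maximal_independent_subset[of ?S] by blast
  have "gf2.span B = cycles"
  proof
    show "gf2.span B \<subseteq> cycles" using B(1) S assms by (intro gf2.span_minimal) auto
    show "cycles \<subseteq> gf2.span B"
      using cycles_subset_span gf2.span_minimal[OF B(3) gf2.subspace_span] by blast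
  qed
  moreover have "finite {b \<in> B. b i \<noteq> 0} \<and> card {b \<in> B. b i \<noteq> 0} \<le> 2" if i: "i \<in> T" for i
  proof -
    have sub: "{b \<in> B. b i \<noteq> 0} \<subseteq> {b \<in> ?S. b i \<noteq> 0}" using B(1) by blast
    then show ?thesis
      using card_cell_boundaries_le_2[OF i] finite_subset[OF sub] card_mono[OF _ sub] le_trans by blast
  qed
  ultimately show ?thesis unfolding two_basis_def is_basis_of_def using B(2) by blast
qed

end

subsection \<open>Vertex sets of simplices in a complex\<close>

lemma simplex_extreme_points:
  assumes "n simplex S"
  shows "\<not> affine_dependent {v. v extreme_point_of S}" "int (card {v. v extreme_point_of S}) = n + 1"
    "convex hull {v. v extreme_point_of S} = S"
proof -
  obtain C where C: "\<not> affine_dependent C" "int (card C) = n + 1" "S = convex hull C"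
    using assms by (auto simp: simplex_def)
  have "{v. v extreme_point_of S} = C"
    unfolding C(3) using extreme_point_of_convex_hull_affine_independent[OF C(1)] by blast
  then show "\<not> affine_dependent {v. v extreme_point_of S}" "int (card {v. v extreme_point_of S}) = n + 1"
    "convex hull {v. v extreme_point_of S} = S"
    using C by auto
qed

lemma simplicial_complex_simplex: "simplicial_complex K \<Longrightarrow> S \<in> K \<Longrightarrow> \<exists>n. n simplex S"
  by (simp add: simplicial_complex_def)

text \<open>This turns geometric incidence into inclusion of vertex sets, the only data that a
  simplicial isomorphism respects.\<close>

lemma face_of_simplex_iff:
  assumes "m simplex E" "n simplex S"
  shows "E face_of S \<longleftrightarrow> {v. v extreme_point_of E} \<subseteq> {v. v extreme_point_of S}"
proof
  assume "E face_of S"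
  then show "{v. v extreme_point_of E} \<subseteq> {v. v extreme_point_of S}"
    using extreme_point_of_face by blast
next
  assume "{v. v extreme_point_of E} \<subseteq> {v. v extreme_point_of S}"
  then show "E face_of S"
    using face_of_convex_hull_affine_independent[OF simplex_extreme_points(1)[OF assms(2)], of E]
      simplex_extreme_points(3)[OF assms(1)] simplex_extreme_points(3)[OF assms(2)] by auto
qed

text \<open>The intersection is a common face, hence itself a simplex of \<open>K\<close>, whose
  vertices belong to both. Disjoint simplices are covered: the empty face is the simplex of
  dimension -1.\<close>

lemma simplicial_complex_hull_Int:
  assumes K: "simplicial_complex K" and S: "S \<in> K" "S' \<in> K"
  shows "S \<inter> S' = convex hull ({v. v extreme_point_of S} \<inter> {v. v extreme_point_of S'})"
proof
  let ?ext = "\<lambda>S. {v. v extreme_point_of S}"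
  obtain n n' where n: "n simplex S" "n' simplex S'" using simplicial_complex_simplex[OF K] S by blast
  have f: "S \<inter> S' face_of S" "S \<inter> S' face_of S'"
    using K S unfolding simplicial_complex_def by (blast, metis inf_commute)
  then have "S \<inter> S' \<in> K" using K S unfolding simplicial_complex_def by blast
  then obtain m where m: "m simplex (S \<inter> S')" using simplicial_complex_simplex[OF K] by blast
  have "?ext (S \<inter> S') \<subseteq> ?ext S \<inter> ?ext S'"
    using f face_of_simplex_iff[OF m n(1)] face_of_simplex_iff[OF m n(2)] by blast
  then show "S \<inter> S' \<subseteq> convex hull (?ext S \<inter> ?ext S')"
    using simplex_extreme_points(3)[OF m] hull_mono by metis
  show "convex hull (?ext S \<inter> ?ext S') \<subseteq> S \<inter> S'"
    using simplex_extreme_points(3)[OF n(1)] simplex_extreme_points(3)[OF n(2)]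
      hull_mono[of "?ext S \<inter> ?ext S'" "?ext S" convex] hull_mono[of "?ext S \<inter> ?ext S'" "?ext S'" convex] by blast
qed

lemma extreme_points_subset_vertices:
  assumes "simplicial_complex K" "S \<in> K"
  shows "{v. v extreme_point_of S} \<subseteq> vertices K"
  using assms face_of_singleton unfolding vertices_def simplicial_complex_def by blast

theorem theorem2:
  fixes \<Delta> :: "'a::euclidean_space set set"
  assumes "triangular_configuration \<Delta>"
    and "embeddable_in_R3 \<Delta>"
  shows "\<exists>B. two_basis (triangles \<Delta>) B (cycle_space \<Delta>)"
proof -
  let ?ext = "\<lambda>S. {v. v extreme_point_of S}"
  have K: "simplicial_complex \<Delta>" using assms(1) by (simp add: triangular_configuration_def)
  obtain L :: "(real^3) set set" and f where L: "simplicial_complex L"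
    and bij: "bij_betw f (vertices \<Delta>) (vertices L)"
    and iso: "\<And>A. A \<subseteq> vertices \<Delta> \<Longrightarrow> A \<in> vertex_scheme \<Delta> \<longleftrightarrow> f ` A \<in> vertex_scheme L"
    using assms(2) unfolding embeddable_in_R3_def simplicially_isomorphic_def triangular_configuration_def by blast
  have inj: "inj_on f (vertices \<Delta>)" using bij by (rule bij_betw_imp_inj_on)
  define \<tau> where "\<tau> t = f ` ?ext t" for t
  have tri: "t \<in> \<Delta>" "2 simplex t" if "t \<in> triangles \<Delta>" for t
    using that by (auto simp: triangles_def)
  have ext_V: "?ext t \<subseteq> vertices \<Delta>" if "t \<in> \<Delta>" for t
    using extreme_points_subset_vertices[OF K that] .
  \<comment> \<open>Membership in the vertex scheme of \<open>L\<close> says that the image points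
    are the vertices of an actual simplex in space; independence and the intersection property of
    \<tau> come from there.\<close>
  have image: "\<exists>S\<in>L. \<tau> t = ?ext S" if "t \<in> \<Delta>" for t
  proof -
    have "?ext t \<in> vertex_scheme \<Delta>" using that by (auto simp: vertex_scheme_def)
    then have "f ` ?ext t \<in> vertex_scheme L" using iso ext_V[OF that] by blast
    then show ?thesis by (auto simp: vertex_scheme_def \<tau>_def)
  qed
  have card_eq: "card (\<tau> t) = card (?ext t)" if "t \<in> \<Delta>" for t
    unfolding \<tau>_def by (rule card_image) (rule inj_on_subset[OF inj ext_V[OF that]])
  interpret triangle_system "triangles \<Delta>" \<tau>
  proof
    show "finite (triangles \<Delta>)" using K by (simp add: triangles_def simplicial_complex_def)
    show "card (\<tau> t) = 3" if "t \<in> triangles \<Delta>" for t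
      using card_eq[OF tri(1)[OF that]] simplex_extreme_points(2)[OF tri(2)[OF that]] by simp
    show "\<not> affine_dependent (\<tau> t)" if "t \<in> triangles \<Delta>" for t
      using image[OF tri(1)[OF that]] simplicial_complex_simplex[OF L] simplex_extreme_points(1) by metis
    show "inj_on \<tau> (triangles \<Delta>)"
    proof (rule inj_onI)
      fix s t assume st: "s \<in> triangles \<Delta>" "t \<in> triangles \<Delta>" "\<tau> s = \<tau> t"
      then have "?ext s = ?ext t"
        using inj_on_image_eq_iff[OF inj ext_V ext_V] tri(1) unfolding \<tau>_def by blast
      then show "s = t" using simplex_extreme_points(3)[OF tri(2)] st by metis
    qed
    show "convex hull \<tau> s \<inter> convex hull \<tau> t = convex hull (\<tau> s \<inter> \<tau> t)"
      if "s \<in> triangles \<Delta>" "t \<in> triangles \<Delta>" for s t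
    proof -
      obtain S S' where S: "S \<in> L" "\<tau> s = ?ext S" "S' \<in> L" "\<tau> t = ?ext S'"
        using image tri(1) \<open>s \<in> triangles \<Delta>\<close> \<open>t \<in> triangles \<Delta>\<close> by meson
      have "convex hull (?ext S) = S" "convex hull (?ext S') = S'"
        using S simplicial_complex_simplex[OF L] simplex_extreme_points(3) by metis+
      then show ?thesis using simplicial_complex_hull_Int[OF L S(1,3)] S by simp
    qed
  qed
  have \<tau>_mono: "\<tau> e \<subseteq> \<tau> t \<longleftrightarrow> ?ext e \<subseteq> ?ext t" if "e \<in> \<Delta>" "t \<in> \<Delta>" for e t
    unfolding \<tau>_def using inj_on_image_subset_iff[OF inj ext_V ext_V] that by blast
  have boundary_eq: "(\<Sum>t\<in>triangles \<Delta>. incidence e t * x t) = boundary x (\<tau> e)" if e: "e \<in> edges \<Delta>" for e and x :: "'a set \<Rightarrow> bit"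
  proof -
    have e': "e \<in> \<Delta>" "1 simplex e" using e by (auto simp: edges_def)
    have "(\<Sum>t\<in>triangles \<Delta>. incidence e t * x t) = (\<Sum>t\<in>triangles \<Delta>. if \<tau> e \<subseteq> \<tau> t then x t else 0)"
      using face_of_simplex_iff[OF e'(2) tri(2)] \<tau>_mono[OF e'(1) tri(1)]
      by (intro sum.cong) (auto simp: incidence_def)
    also have "\<dots> = boundary x (\<tau> e)"
      unfolding boundary_def using finite_T by (simp only: sum.inter_filter)
    finally show ?thesis .
  qed
  \<comment> \<open>A pair inside \<tau> \<open>t\<close> pulls back to two vertices of
    \<open>t\<close>, and these span a side of \<open>t\<close>, which belongs to the
    complex.\<close>
  have edge_eq: "\<exists>e\<in>edges \<Delta>. E = \<tau> e" if E: "card E = 2" and t: "t \<in> triangles \<Delta>" "E \<subseteq> \<tau> t" for E t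
  proof -
    obtain E0 where E0: "E0 \<subseteq> ?ext t" "E = f ` E0"
      using t(2) unfolding \<tau>_def by (auto simp: subset_image_iff)
    have ind: "\<not> affine_dependent E0"
      using E0(1) simplex_extreme_points(1)[OF tri(2)[OF t(1)]] affine_dependent_subset by blast
    have "card E0 = 2"
      using E E0 card_image[OF inj_on_subset[OF inj subset_trans[OF E0(1) ext_V[OF tri(1)[OF t(1)]]]]] by simp
    then have s: "1 simplex (convex hull E0)" using ind by (intro simplex_convex_hull) simp
    have ext: "?ext (convex hull E0) = E0"
      using extreme_point_of_convex_hull_affine_independent[OF ind] by blast
    then have "convex hull E0 face_of t" using face_of_simplex_iff[OF s tri(2)[OF t(1)]] E0(1) by simp
    then have "convex hull E0 \<in> \<Delta>" using K tri(1)[OF t(1)] unfolding simplicial_complex_def by blast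
    then have "convex hull E0 \<in> edges \<Delta>" using s by (simp add: edges_def)
    then show ?thesis using ext E0(2) unfolding \<tau>_def by metis
  qed
  have "cycles = cycle_space \<Delta>"
  proof -
    \<comment> \<open>A pair of points contained in no \<tau> \<open>t\<close> imposes the empty
      condition, so ranging over all pairs in space adds nothing to the edges of the
      configuration.\<close>
    have "(\<forall>E. card E = 2 \<longrightarrow> boundary x E = 0) \<longleftrightarrow> (\<forall>e\<in>edges \<Delta>. boundary x (\<tau> e) = 0)" for x
    proof
      assume l: "\<forall>E. card E = 2 \<longrightarrow> boundary x E = 0"
      show "\<forall>e\<in>edges \<Delta>. boundary x (\<tau> e) = 0"
      proof
        fix e assume "e \<in> edges \<Delta>"
        then have "e \<in> \<Delta>" "1 simplex e" by (auto simp: edges_def)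
        then have "card (\<tau> e) = 2" using card_eq[of e] simplex_extreme_points(2)[of 1 e] by simp
        then show "boundary x (\<tau> e) = 0" using l by blast
      qed
    next
      assume r: "\<forall>e\<in>edges \<Delta>. boundary x (\<tau> e) = 0"
      show "\<forall>E. card E = 2 \<longrightarrow> boundary x E = 0"
      proof (intro allI impI)
        fix E :: "(real^3) set" assume E: "card E = 2"
        show "boundary x E = 0"
        proof (cases "\<exists>t\<in>triangles \<Delta>. E \<subseteq> \<tau> t")
          case True then show ?thesis using edge_eq[OF E] r by blast
        next
          case False
          then have "{t \<in> triangles \<Delta>. E \<subseteq> \<tau> t} = {}" by blast
          then show ?thesis by (simp only: boundary_def sum.empty)
        qed
      qed
    qed
    then show ?thesis unfolding cycles_def cycle_space_def using boundary_eq by simp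
  qed
  then show ?thesis using two_basis_exists subspace_cycle_space[of \<Delta>] by simp
qed

end
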